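(* Let $m, n \in \mathbb{N}$ with $m \geq 5$ and $n \geq 2$. Let $G$ be the disjoint union of cycles $C_{k_1},\ldots,C_{k_n}$ with each $k_i \geq 3$, and let $M = K_1 \vee G$. Then $P_{DP}(M,m) = P(M,m)$. Consequently, $\tau_{DP}(M) \leq 5$.
   Context: All graphs are finite and simple; $K_1 \vee G$ is the join of a single vertex with $G$. A cover of a graph $G$ is a pair $\mathcal{H}=(L,H)$ where $H$ is a graph and $L: V(G) \to \mathcal{P}(V(H))$ satisfies: (1) $\{L(u): u \in V(G)\}$ is a partition of $V(H)$ into $|V(G)|$ parts; (2) $H[L(u)]$ is complete for each $u$; (3) if there is an edge of $H$ between $L(u)$ and $L(v)$ with $u \neq v$, then $uv \in E(G)$; (4) if $uv \in E(G)$, the edges of $H$ between $L(u)$ and $L(v)$ form a (possibly empty) matching. The cover is $m$-fold if $|L(u)|=m$ for all $u$. An $\mathcal{H}$-coloring is an independent set of $H$ of size $|V(G)|$. $P_{DP}(G,m)$ is the minimum number of $\mathcal{H}$-colorings over all $m$-fold covers; $P(G,m)$ is the chromatic polynomial. $\tau_{DP}(G)$ is the smallest $N \geq \chi(G)$ such that $P_{DP}(G,m)=P(G,m)$ for all $m \geq N$ (and $\infty$ if no such $N$ exists). *)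

theory Defs
  imports "HOL-Library.Disjoint_Sets" "HOL-Library.FuncSet" "HOL-Library.Extended_Nat"
begin

record 'a sgraph =
  verts :: "'a set"
  edges :: "'a set set"

definition simple_graph :: "'a sgraph \<Rightarrow> bool" where
  "simple_graph G \<longleftrightarrow> finite (verts G) \<and> (\<forall>e\<in>edges G. e \<subseteq> verts G \<and> card e = 2)"

definition graph_iso :: "'a sgraph \<Rightarrow> 'b sgraph \<Rightarrow> bool" (infix "\<cong>\<^sub>g" 50) where
  "G \<cong>\<^sub>g H \<longleftrightarrow> (\<exists>f. bij_betw f (verts G) (verts H) \<and>
     (\<forall>u\<in>verts G. \<forall>v\<in>verts G. {u, v} \<in> edges G \<longleftrightarrow> {f u, f v} \<in> edges H))"

definition K1 :: "unit sgraph" where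
  "K1 = \<lparr>verts = {()}, edges = {}\<rparr>"

definition cycle_graph :: "nat \<Rightarrow> nat sgraph" where
  "cycle_graph k = \<lparr>verts = {..<k}, edges = {{i, Suc i mod k} | i. i < k}\<rparr>"

definition disjoint_union :: "'i set \<Rightarrow> ('i \<Rightarrow> 'a sgraph) \<Rightarrow> ('i \<times> 'a) sgraph" where
  "disjoint_union I F =
     \<lparr>verts = (SIGMA i:I. verts (F i)),
      edges = (\<Union>i\<in>I. (\<lambda>e. Pair i ` e) ` edges (F i))\<rparr>"

definition graph_join :: "'a sgraph \<Rightarrow> 'b sgraph \<Rightarrow> ('a + 'b) sgraph" where
  "graph_join G H =
     \<lparr>verts = verts G <+> verts H,
      edges = (\<lambda>e. Inl ` e) ` edges G \<union> (\<lambda>e. Inr ` e) ` edges H \<union>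
              {{Inl u, Inr v} | u v. u \<in> verts G \<and> v \<in> verts H}\<rparr>"

definition proper_colorings :: "'a sgraph \<Rightarrow> nat \<Rightarrow> ('a \<Rightarrow> nat) set" where
  "proper_colorings G m =
     {c \<in> verts G \<rightarrow>\<^sub>E {1..m}. \<forall>u v. {u, v} \<in> edges G \<longrightarrow> c u \<noteq> c v}"

text \<open>The value at \<open>m\<close> of the chromatic polynomial, i.e. the number of proper \<open>m\<close>-colorings.\<close>

definition chromatic_poly :: "'a sgraph \<Rightarrow> nat \<Rightarrow> nat" where
  "chromatic_poly G m = card (proper_colorings G m)"

definition chromatic_number :: "'a sgraph \<Rightarrow> nat" where
  "chromatic_number G = (LEAST m. proper_colorings G m \<noteq> {})"

definition edges_between :: "'a sgraph \<Rightarrow> 'a set \<Rightarrow> 'a set \<Rightarrow> 'a set set" where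
  "edges_between H A B = {{x, y} | x y. x \<in> A \<and> y \<in> B \<and> {x, y} \<in> edges H}"

definition cover :: "'a sgraph \<Rightarrow> ('a \<Rightarrow> 'b set) \<Rightarrow> 'b sgraph \<Rightarrow> bool" where
  "cover G L H \<longleftrightarrow>
     simple_graph H \<and>
     partition_on (verts H) (L ` verts G) \<and> card (L ` verts G) = card (verts G) \<and>
     (\<forall>u\<in>verts G. \<forall>x\<in>L u. \<forall>y\<in>L u. x \<noteq> y \<longrightarrow> {x, y} \<in> edges H) \<and>
     (\<forall>u\<in>verts G. \<forall>v\<in>verts G. u \<noteq> v \<and> edges_between H (L u) (L v) \<noteq> {} \<longrightarrow> {u, v} \<in> edges G) \<and>
     (\<forall>u v. {u, v} \<in> edges G \<longrightarrow> disjoint (edges_between H (L u) (L v)))"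

definition m_fold_cover :: "nat \<Rightarrow> 'a sgraph \<Rightarrow> ('a \<Rightarrow> 'b set) \<Rightarrow> 'b sgraph \<Rightarrow> bool" where
  "m_fold_cover m G L H \<longleftrightarrow> cover G L H \<and> (\<forall>u\<in>verts G. card (L u) = m)"

definition independent_set :: "'a sgraph \<Rightarrow> 'a set \<Rightarrow> bool" where
  "independent_set H S \<longleftrightarrow> S \<subseteq> verts H \<and> (\<forall>x\<in>S. \<forall>y\<in>S. {x, y} \<notin> edges H)"

definition cover_colorings :: "'a sgraph \<Rightarrow> 'b sgraph \<Rightarrow> 'b set set" where
  "cover_colorings G H = {S. independent_set H S \<and> card S = card (verts G)}"

text \<open>The vertices of the covers are taken from \<open>nat\<close>, which is no restriction since every finite
  graph has an isomorphic copy there; see \<open>P_DP_le\<close> below.\<close>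

definition P_DP :: "'a sgraph \<Rightarrow> nat \<Rightarrow> nat" where
  "P_DP G m = Inf {card (cover_colorings G H) | (L :: 'a \<Rightarrow> nat set) H. m_fold_cover m G L H}"

definition tau_bound :: "'a sgraph \<Rightarrow> nat \<Rightarrow> bool" where
  "tau_bound G N \<longleftrightarrow>
     N \<ge> chromatic_number G \<and> (\<forall>m\<ge>N. P_DP G m = chromatic_poly G m)"

definition tau_DP :: "'a sgraph \<Rightarrow> enat" where
  "tau_DP G = (if \<exists>N. tau_bound G N then enat (LEAST N. tau_bound G N) else \<infinity>)"

lemma simple_graph_cycle:
  assumes "k \<ge> 3" shows "simple_graph (cycle_graph k)"
proof -
  have "i \<noteq> Suc i mod k" if "i < k" for i
    using that assms by (cases "Suc i = k") auto
  then show ?thesis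
    using assms by (auto simp: simple_graph_def cycle_graph_def card_2_iff)
qed

lemma simple_graph_disjoint_union:
  assumes "finite I" "\<And>i. i \<in> I \<Longrightarrow> simple_graph (F i)"
  shows "simple_graph (disjoint_union I F)"
  using assms by (fastforce simp: simple_graph_def disjoint_union_def card_image inj_on_def)

lemma simple_graph_join:
  assumes "simple_graph G" "simple_graph H" shows "simple_graph (graph_join G H)"
  using assms by (fastforce simp: simple_graph_def graph_join_def card_image inj_on_def)

lemma P_DP_le:
  fixes G :: "'a sgraph" and L :: "'a \<Rightarrow> 'b set"
  assumes G: "simple_graph G" and cov: "m_fold_cover m G L H"
  shows "P_DP G m \<le> card (cover_colorings G H)"
proof -
  have sg: "simple_graph H" and part: "partition_on (verts H) (L ` verts G)"
    using cov by (auto simp: m_fold_cover_def cover_def)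
  then obtain f :: "'b \<Rightarrow> nat" where f: "inj_on f (verts H)"
    using finite_imp_inj_to_nat_seg by (metis simple_graph_def)
  define H' where "H' = \<lparr>verts = f ` verts H, edges = (\<lambda>e. f ` e) ` edges H\<rparr>"
  define L' where "L' u = f ` L u" for u
  have esub: "e \<subseteq> verts H" if "e \<in> edges H" for e
    using that sg by (auto simp: simple_graph_def)
  have Lsub: "L u \<subseteq> verts H" if "u \<in> verts G" for u
    using that part by (auto simp: partition_on_def)
  have img_eq: "f ` A = f ` B \<longleftrightarrow> A = B" if "A \<subseteq> verts H" "B \<subseteq> verts H" for A B
    using f that by (simp add: inj_on_image_eq_iff)
  have edge_iff: "{f x, f y} \<in> edges H' \<longleftrightarrow> {x, y} \<in> edges H"
    if "x \<in> verts H" "y \<in> verts H" for x y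
  proof -
    have "{f x, f y} \<in> edges H' \<longleftrightarrow> (\<exists>e\<in>edges H. f ` {x, y} = f ` e)"
      by (auto simp: H'_def)
    also have "\<dots> \<longleftrightarrow> {x, y} \<in> edges H"
      using img_eq[of "{x, y}"] esub that by blast
    finally show ?thesis .
  qed
  have sg': "simple_graph H'"
    using sg f by (force simp: simple_graph_def H'_def card_image inj_on_subset)
  have between: "edges_between H' (f ` A) (f ` B) = (\<lambda>e. f ` e) ` edges_between H A B"
    if "A \<subseteq> verts H" "B \<subseteq> verts H" for A B
  proof (intro set_eqI iffI)
    fix e assume "e \<in> edges_between H' (f ` A) (f ` B)"
    then obtain x y where "x \<in> A" "y \<in> B" "e = {f x, f y}" "{f x, f y} \<in> edges H'"
      by (auto simp: edges_between_def)
    moreover from this have "{x, y} \<in> edges H"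
      using edge_iff that by blast
    ultimately have "e = f ` {x, y}" "{x, y} \<in> edges_between H A B"
      by (auto simp: edges_between_def)
    then show "e \<in> (\<lambda>e. f ` e) ` edges_between H A B" by blast
  next
    fix e assume "e \<in> (\<lambda>e. f ` e) ` edges_between H A B"
    then obtain x y where xy: "x \<in> A" "y \<in> B" "e = {f x, f y}" "{x, y} \<in> edges H"
      by (auto simp: edges_between_def)
    then have "{f x, f y} \<in> edges H'"
      using edge_iff that by blast
    with xy show "e \<in> edges_between H' (f ` A) (f ` B)"
      by (auto simp: edges_between_def)
  qed
  have part': "partition_on (verts H') (L' ` verts G)"
  proof (rule partition_onI)
    show "\<Union> (L' ` verts G) = verts H'"
      using partition_onD1[OF part] by (auto simp: L'_def H'_def)
  next
    fix p q assume "p \<in> L' ` verts G" "q \<in> L' ` verts G" "p \<noteq> q"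
    then obtain u v where uv: "u \<in> verts G" "v \<in> verts G" "p = f ` L u" "q = f ` L v" "L u \<noteq> L v"
      by (auto simp: L'_def)
    then have "L u \<inter> L v = {}"
      using partition_onD2[OF part] by (auto simp: disjoint_def)
    then have "f ` L u \<inter> f ` L v = {}"
      using inj_on_image_Int[OF f Lsub Lsub] uv by (metis image_empty)
    then show "disjnt p q" using uv by (simp add: disjnt_def)
  next
    show "{} \<notin> L' ` verts G" using partition_onD3[OF part] by (auto simp: L'_def)
  qed
  have cardL: "card (L' ` verts G) = card (L ` verts G)"
  proof -
    have "L' ` verts G = (\<lambda>A. f ` A) ` (L ` verts G)" by (auto simp: L'_def)
    moreover have "inj_on (\<lambda>A. f ` A) (L ` verts G)"
      using img_eq Lsub by (auto simp: inj_on_def)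
    ultimately show ?thesis by (simp add: card_image)
  qed
  have *: "disjoint ((\<lambda>e. f ` e) ` E)" if "disjoint E" "\<And>e. e \<in> E \<Longrightarrow> e \<subseteq> verts H" for E
  proof -
    have "f ` a \<inter> f ` b = {}" if "a \<in> E" "b \<in> E" "f ` a \<noteq> f ` b" for a b
    proof -
      have "a \<inter> b = {}" using \<open>disjoint E\<close> that by (auto simp: disjoint_def)
      then show ?thesis
        using inj_on_image_Int[OF f, of a b] that \<open>\<And>e. e \<in> E \<Longrightarrow> e \<subseteq> verts H\<close> by (metis image_empty)
    qed
    then show ?thesis by (auto simp: disjoint_def)
  qed
  have matching: "disjoint (edges_between H' (L' u) (L' v))"
    if gp: "{u, v} \<in> edges G" for u v
  proof -
    have uv: "u \<in> verts G" "v \<in> verts G" using gp G by (auto simp: simple_graph_def)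
    have "disjoint (edges_between H (L u) (L v))"
      using cov gp by (auto simp: m_fold_cover_def cover_def)
    then show ?thesis
      unfolding L'_def between[OF Lsub[OF uv(1)] Lsub[OF uv(2)]]
      by (rule *) (use esub in \<open>auto simp: edges_between_def\<close>)
  qed
  have complete: "{x', y'} \<in> edges H'"
    if as: "u \<in> verts G" "x' \<in> L' u" "y' \<in> L' u" "x' \<noteq> y'" for u x' y'
  proof -
    obtain x y where xy: "x \<in> L u" "y \<in> L u" "x' = f x" "y' = f y" "x \<noteq> y"
      using as(2-4) unfolding L'_def by blast
    then have "{x, y} \<in> edges H"
      using cov as(1) by (auto simp: m_fold_cover_def cover_def)
    then show ?thesis using edge_iff Lsub[OF as(1)] xy by blast
  qed
  have nonadj: "{u, v} \<in> edges G"
    if uv: "u \<in> verts G" "v \<in> verts G" "u \<noteq> v" "edges_between H' (L' u) (L' v) \<noteq> {}" for u v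
  proof -
    have "edges_between H (L u) (L v) \<noteq> {}"
      using uv(4) unfolding L'_def between[OF Lsub[OF uv(1)] Lsub[OF uv(2)]] by simp
    then show ?thesis using cov uv(1-3) by (auto simp: m_fold_cover_def cover_def)
  qed
  have "card (L' u) = m" if "u \<in> verts G" for u
    using cov that inj_on_subset[OF f Lsub[OF that]]
    by (simp add: L'_def card_image m_fold_cover_def)
  moreover have "card (L ` verts G) = card (verts G)"
    using cov by (simp add: m_fold_cover_def cover_def)
  ultimately have cov': "m_fold_cover m G L' H'"
    unfolding m_fold_cover_def cover_def
    using sg' part' cardL complete nonadj matching by simp
  have "cover_colorings G H' = (\<lambda>S. f ` S) ` cover_colorings G H"
  proof (intro set_eqI iffI)
    fix T assume T: "T \<in> cover_colorings G H'"
    then obtain S where S: "S \<subseteq> verts H" "T = f ` S"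
      by (auto simp: cover_colorings_def independent_set_def H'_def subset_image_iff)
    have "card S = card T" using S inj_on_subset[OF f] by (simp add: card_image)
    moreover have "{x, y} \<notin> edges H" if "x \<in> S" "y \<in> S" for x y
      using T S that edge_iff[of x y] by (auto simp: cover_colorings_def independent_set_def)
    ultimately have "S \<in> cover_colorings G H"
      using T S by (auto simp: cover_colorings_def independent_set_def)
    with S show "T \<in> (\<lambda>S. f ` S) ` cover_colorings G H" by blast
  next
    fix T assume "T \<in> (\<lambda>S. f ` S) ` cover_colorings G H"
    then obtain S where S: "S \<in> cover_colorings G H" "T = f ` S" by blast
    then have sub: "S \<subseteq> verts H" by (simp add: cover_colorings_def independent_set_def)
    have "{f x, f y} \<notin> edges H'" if "x \<in> S" "y \<in> S" for x y
      using S sub that edge_iff[of x y] by (auto simp: cover_colorings_def independent_set_def)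
    moreover have "card T = card S" using S sub inj_on_subset[OF f] by (simp add: card_image)
    moreover have "T \<subseteq> verts H'" using S sub by (auto simp: H'_def)
    ultimately show "T \<in> cover_colorings G H'"
      using S by (auto simp: cover_colorings_def independent_set_def)
  qed
  moreover have "inj_on (\<lambda>S. f ` S) (cover_colorings G H)"
    using img_eq by (auto simp: inj_on_def cover_colorings_def independent_set_def)
  ultimately have "card (cover_colorings G H') = card (cover_colorings G H)"
    by (simp add: card_image)
  moreover have "P_DP G m \<le> card (cover_colorings G H')"
    unfolding P_DP_def by (rule wellorder_Inf_le1) (use cov' in blast)
  ultimately show ?thesis by simp
qed

end

theory Submission
  imports Defs Complex_Main
begin

text \<open>
  Let \<open>p = m - 1\<close> and let \<open>X\<close> be the list of the apex. Extending all matchings of a cover to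
  perfect ones and identifying every list with \<open>X\<close> along the spokes, the cover becomes a
  permutation \<open>\<pi> i j\<close> of \<open>X\<close> for each cycle edge, and the number of colorings is at least
  \<open>\<Sum>x\<in>X. \<Prod>i. N i x\<close>, where \<open>N i x\<close> counts the closed walks \<open>e\<close> in \<open>X - {x}\<close> around the \<open>i\<close>-th cycle
  with \<open>\<pi> i j (e j) \<noteq> e (j + 1)\<close>. If all permutations are the identity, then \<open>N i x\<close> is
  \<open>P = (p - 1)^k + (-1)^k (p - 1)\<close> with \<open>k = k i\<close>. By the inequality of arithmetic and geometric means it
  suffices to show \<open>(\<Prod>x\<in>X. N i x) \<ge> P^m\<close> for each single cycle.

  Making \<open>\<pi> i j\<close> bypass \<open>x\<close> gives permutations of \<open>X - {x}\<close>; a transfer-matrix computation counts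
  their closed walks as \<open>(p - 1)^k - (-1)^k + (-1)^k f\<close>, where \<open>f\<close> is the number of fixed points of the
  composition. If \<open>k\<close> is odd, this is at least \<open>P\<close>. If \<open>k\<close> is even, let \<open>s\<close> be the number of points
  fixed by all \<open>\<pi> i j\<close> and \<open>t = m - s\<close>. For these \<open>s\<close> points \<open>N i x \<ge> P - t\<close>. Each of the \<open>t\<close> other points
  lacks at least one edge of the bypassed cover, and the walks through this missing edge yield
  \<open>N i x \<ge> P + q + s\<close> with \<open>q \<ge> p - 1\<close>, where \<open>m \<ge> 5\<close> is needed. Bernoulli's inequality concludes.
\<close>

section \<open>Transfer matrices of permutations\<close>

text \<open>The relation may vary with the step because each edge of a cycle carries its own
  matching. Walks are extensional functions, so that they can be counted.\<close>

definition closed_walks :: "nat \<Rightarrow> 'a set \<Rightarrow> (nat \<Rightarrow> 'a \<Rightarrow> 'a \<Rightarrow> bool) \<Rightarrow> (nat \<Rightarrow> 'a) set" where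
  "closed_walks k Y R = {e \<in> {..<k} \<rightarrow>\<^sub>E Y. \<forall>j<k. R j (e j) (e (Suc j mod k))}"

definition walks :: "nat \<Rightarrow> 'a set \<Rightarrow> (nat \<Rightarrow> 'a \<Rightarrow> 'a \<Rightarrow> bool) \<Rightarrow> 'a \<Rightarrow> 'a \<Rightarrow> (nat \<Rightarrow> 'a) set" where
  "walks k Y R a b = {e \<in> {..k} \<rightarrow>\<^sub>E Y. e 0 = a \<and> e k = b \<and> (\<forall>j<k. R j (e j) (e (Suc j)))}"

section \<open>Finiteness, monotonicity and rotation of closed walks\<close>

lemma finite_closed_walks: "finite Y \<Longrightarrow> finite (closed_walks k Y R)"
  unfolding closed_walks_def by (rule finite_subset[OF _ finite_PiE[of "{..<k}" "\<lambda>_. Y"]]) auto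

lemma finite_walks: "finite Y \<Longrightarrow> finite (walks k Y R a b)"
  unfolding walks_def by (rule finite_subset[OF _ finite_PiE[of "{..k}" "\<lambda>_. Y"]]) auto

lemma closed_walks_mono:
  assumes "\<And>j a b. j < k \<Longrightarrow> a \<in> Y \<Longrightarrow> b \<in> Y \<Longrightarrow> R j a b \<Longrightarrow> R' j a b"
  shows "closed_walks k Y R \<subseteq> closed_walks k Y R'"
proof
  fix e assume e: "e \<in> closed_walks k Y R"
  have "R' j (e j) (e (Suc j mod k))" if "j < k" for j
  proof -
    have "Suc j mod k < k" using that by simp
    then have "e j \<in> Y" "e (Suc j mod k) \<in> Y" "R j (e j) (e (Suc j mod k))"
      using e that by (auto simp: closed_walks_def)
    then show ?thesis using assms that by blast
  qed
  then show "e \<in> closed_walks k Y R'" using e by (auto simp: closed_walks_def)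
qed

text \<open>Reading a closed walk from another starting position is injective. This allows any
  chosen edge of a cycle to be made its last one.\<close>

lemma card_closed_walks_rotate_le:
  assumes "finite Y" "r \<le> k"
  shows "card (closed_walks k Y (\<lambda>j. R ((j + r) mod k))) \<le> card (closed_walks k Y R)"
proof (cases "k = 0")
  case True
  then show ?thesis by (simp add: closed_walks_def)
next
  case False
  \<comment> \<open>The shift by \<open>k - r\<close> inverts the shift by \<open>r\<close> modulo
    \<open>k\<close> within the naturals, because \<open>r \<le> k\<close>.\<close>
  define \<phi> where "\<phi> e = restrict (\<lambda>j. e ((j + (k - r)) mod k)) {..<k}" for e :: "nat \<Rightarrow> 'a"
  have unshift: "((j + r) mod k + (k - r)) mod k = j" if "j < k" for j
    using that assms(2) by (subst mod_add_left_eq) simp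
  have shift: "((j + (k - r)) mod k + r) mod k = j" if "j < k" for j
    using that assms(2) by (subst mod_add_left_eq) simp
  show ?thesis
  proof (rule card_inj_on_le)
    show "inj_on \<phi> (closed_walks k Y (\<lambda>j. R ((j + r) mod k)))"
    proof (rule inj_onI)
      fix e e' assume e: "e \<in> closed_walks k Y (\<lambda>j. R ((j + r) mod k))"
        and e': "e' \<in> closed_walks k Y (\<lambda>j. R ((j + r) mod k))" and eq: "\<phi> e = \<phi> e'"
      have "e j = e' j" if "j < k" for j
        using fun_cong[OF eq, of "(j + r) mod k"] unshift[OF that] False by (simp add: \<phi>_def)
      then show "e = e'"
        using e e' by (intro PiE_ext[of e "{..<k}" "\<lambda>_. Y"]) (auto simp: closed_walks_def)
    qed
    show "\<phi> ` closed_walks k Y (\<lambda>j. R ((j + r) mod k)) \<subseteq> closed_walks k Y R"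
    proof (rule image_subsetI)
      fix e assume e: "e \<in> closed_walks k Y (\<lambda>j. R ((j + r) mod k))"
      have "R j (\<phi> e j) (\<phi> e (Suc j mod k))" if "j < k" for j
      proof -
        define i where "i = (j + (k - r)) mod k"
        have "i < k" using False by (simp add: i_def)
        then have "R ((i + r) mod k) (e i) (e (Suc i mod k))"
          using e by (simp add: closed_walks_def)
        moreover have "(i + r) mod k = j" using shift that by (simp add: i_def)
        moreover have "(Suc j mod k + (k - r)) mod k = Suc i mod k"
          unfolding i_def by (simp add: mod_simps)
        ultimately show ?thesis using that False by (simp add: \<phi>_def i_def)
      qed
      then show "\<phi> e \<in> closed_walks k Y R"
        using e False by (auto simp: closed_walks_def \<phi>_def)
    qed
  qed (rule finite_closed_walks[OF assms(1)])
qed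

text \<open>The trace of a product of transfer matrices. Restriction drops the repeated endpoint of
  a walk from \<open>a\<close> to \<open>a\<close>, and \<open>e(k := e 0)\<close> restores
  it.\<close>

lemma card_closed_walks:
  assumes "finite Y" "k > 0"
  shows "card (closed_walks k Y R) = (\<Sum>a\<in>Y. card (walks k Y R a a))"
proof -
  have "bij_betw (\<lambda>e. restrict e {..<k}) (\<Union>a\<in>Y. walks k Y R a a) (closed_walks k Y R)"
  proof (rule bij_betw_byWitness[where f' = "\<lambda>e. e(k := e 0)"])
    show "\<forall>e\<in>\<Union>a\<in>Y. walks k Y R a a. (restrict e {..<k})(k := restrict e {..<k} 0) = e"
      using assms by (auto simp: walks_def fun_eq_iff PiE_def extensional_def)
    show "\<forall>e\<in>closed_walks k Y R. restrict (e(k := e 0)) {..<k} = e"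
      by (auto simp: closed_walks_def fun_eq_iff PiE_def extensional_def)
    show "(\<lambda>e. restrict e {..<k}) ` (\<Union>a\<in>Y. walks k Y R a a) \<subseteq> closed_walks k Y R"
    proof (rule image_subsetI)
      fix e assume "e \<in> (\<Union>a\<in>Y. walks k Y R a a)"
      then have e: "e \<in> {..k} \<rightarrow>\<^sub>E Y" "e 0 = e k" "\<And>j. j < k \<Longrightarrow> R j (e j) (e (Suc j))"
        by (auto simp: walks_def)
      have "R j (e j) (e (Suc j mod k))" if "j < k" for j
        using e(2) e(3)[OF that] that by (cases "Suc j = k") auto
      then show "restrict e {..<k} \<in> closed_walks k Y R"
        using e assms by (auto simp: closed_walks_def)
    qed
    show "(\<lambda>e. e(k := e 0)) ` closed_walks k Y R \<subseteq> (\<Union>a\<in>Y. walks k Y R a a)"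
    proof (rule image_subsetI)
      fix e assume e: "e \<in> closed_walks k Y R"
      have R: "R j (e j) (if Suc j = k then e 0 else e (Suc j))" if "j < k" for j
      proof (cases "Suc j = k")
        case True
        have "R j (e j) (e (Suc j mod k))" using e that by (simp add: closed_walks_def)
        then show ?thesis using True by simp
      next
        case False
        then have "Suc j mod k = Suc j" using that by simp
        moreover have "R j (e j) (e (Suc j mod k))" using e that by (simp add: closed_walks_def)
        ultimately show ?thesis using False by simp
      qed
      have "e \<in> {..<k} \<rightarrow>\<^sub>E Y" using e by (simp add: closed_walks_def)
      then have "e 0 \<in> Y" "e(k := e 0) \<in> {..k} \<rightarrow>\<^sub>E Y"
        using assms by (auto simp: PiE_def extensional_def Pi_def)
      then have "e(k := e 0) \<in> walks k Y R (e 0) (e 0)"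
        using R assms by (simp add: walks_def)
      with \<open>e 0 \<in> Y\<close> show "e(k := e 0) \<in> (\<Union>a\<in>Y. walks k Y R a a)" by blast
    qed
  qed
  then have "card (closed_walks k Y R) = card (\<Union>a\<in>Y. walks k Y R a a)"
    by (simp add: bij_betw_same_card)
  also have "\<dots> = (\<Sum>a\<in>Y. card (walks k Y R a a))"
    by (rule card_UN_disjoint) (use assms finite_walks in \<open>auto simp: walks_def\<close>)
  finally show ?thesis .
qed

lemma card_walks_0:
  assumes "a \<in> Y" "b \<in> Y"
  shows "card (walks 0 Y R a b) = (if a = b then 1 else 0)"
proof (cases "a = b")
  case True
  have "walks 0 Y R a b = {restrict (\<lambda>_. a) {..0}}"
    using True assms by (auto simp: walks_def fun_eq_iff PiE_def extensional_def)
  then show ?thesis using True by simp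
next
  case False
  then have "walks 0 Y R a b = {}" by (auto simp: walks_def)
  with False show ?thesis by simp
qed

lemma card_walks_Suc:
  assumes "finite Y" "b \<in> Y"
  shows "card (walks (Suc k) Y R a b) = (\<Sum>b'\<in>{b'\<in>Y. R k b' b}. card (walks k Y R a b'))"
proof -
  let ?B = "{b'\<in>Y. R k b' b}"
  have "bij_betw (\<lambda>e. restrict e {..k}) (walks (Suc k) Y R a b) (\<Union>b'\<in>?B. walks k Y R a b')"
  proof (rule bij_betw_byWitness[where f' = "\<lambda>e. e(Suc k := b)"])
    show "\<forall>e\<in>walks (Suc k) Y R a b. (restrict e {..k})(Suc k := b) = e"
      by (auto simp: walks_def fun_eq_iff PiE_def extensional_def)
    show "\<forall>e\<in>\<Union>b'\<in>?B. walks k Y R a b'. restrict (e(Suc k := b)) {..k} = e"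
      by (auto simp: walks_def fun_eq_iff PiE_def extensional_def)
    show "(\<lambda>e. restrict e {..k}) ` walks (Suc k) Y R a b \<subseteq> (\<Union>b'\<in>?B. walks k Y R a b')"
      by (auto simp: walks_def PiE_def Pi_def)
    show "(\<lambda>e. e(Suc k := b)) ` (\<Union>b'\<in>?B. walks k Y R a b') \<subseteq> walks (Suc k) Y R a b"
      using assms(2) by (auto simp: walks_def PiE_def extensional_def Pi_def less_Suc_eq)
  qed
  then have "card (walks (Suc k) Y R a b) = card (\<Union>b'\<in>?B. walks k Y R a b')"
    by (simp add: bij_betw_same_card)
  also have "\<dots> = (\<Sum>b'\<in>?B. card (walks k Y R a b'))"
    by (rule card_UN_disjoint) (use assms finite_walks in \<open>auto simp: walks_def\<close>)
  finally show ?thesis .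
qed

primrec comp_upto :: "(nat \<Rightarrow> 'a \<Rightarrow> 'a) \<Rightarrow> nat \<Rightarrow> 'a \<Rightarrow> 'a" where
  "comp_upto \<rho> 0 = id"
| "comp_upto \<rho> (Suc k) = \<rho> k \<circ> comp_upto \<rho> k"

lemma comp_upto_mem:
  assumes "\<And>j. j < k \<Longrightarrow> bij_betw (\<rho> j) Y Y" "a \<in> Y"
  shows "comp_upto \<rho> k a \<in> Y"
  using assms(1)
proof (induction k)
  case (Suc k)
  then have "comp_upto \<rho> k a \<in> Y" "bij_betw (\<rho> k) Y Y" by auto
  then show ?case by (auto dest: bij_betwE)
qed (use assms(2) in simp)

lemma comp_upto_fixed:
  assumes "\<And>j. j < k \<Longrightarrow> \<rho> j a = a"
  shows "comp_upto \<rho> k a = a"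
  using assms by (induction k) auto

text \<open>
  A product of \<open>k\<close> matrices \<open>J - Q\<close>, with \<open>J\<close> the all-ones matrix of size \<open>p\<close> and \<open>Q\<close> permutation
  matrices, is \<open>walk_base p k\<close> times \<open>J\<close> plus \<open>(-1)^k\<close> times a permutation matrix.
\<close>

primrec walk_base :: "int \<Rightarrow> nat \<Rightarrow> int" where
  "walk_base p 0 = 0"
| "walk_base p (Suc k) = (p - 1) * walk_base p k + (-1) ^ k"

text \<open>The solution of the recurrence, multiplied by \<open>p\<close> to stay within the
  integers; this product is also the trace of \<open>walk_base p k\<close> times the all-ones
  matrix.\<close>

lemma walk_base_closed_form: "p * walk_base p k = (p - 1) ^ k - (-1) ^ k"
proof (induction k)
  case (Suc k)
  have "p * walk_base p (Suc k) = (p - 1) * (p * walk_base p k) + p * (-1) ^ k"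
    by (simp add: algebra_simps)
  then show ?case by (simp add: Suc algebra_simps)
qed simp

text \<open>Induction by (b J + (-1)^k Q) (J - Q') = ((p - 1) b + (-1)^k) J - (-1)^k Q Q', which
  holds because J J = p J and Q J = J Q' = J. The statement reads off one entry.\<close>

lemma card_walks_avoiding:
  assumes "finite Y" "\<And>j. j < k \<Longrightarrow> bij_betw (\<rho> j) Y Y" "a \<in> Y" "b \<in> Y"
  shows "int (card (walks k Y (\<lambda>j u v. \<rho> j u \<noteq> v) a b)) =
    walk_base (int (card Y)) k + (-1) ^ k * of_bool (comp_upto \<rho> k a = b)"
  using assms(2,4)
proof (induction k arbitrary: b)
  case 0
  then show ?case using assms(3) by (simp add: card_walks_0)
next
  case (Suc k)
  let ?R = "\<lambda>j u v. \<rho> j u \<noteq> v" and ?p = "int (card Y)" and ?d = "comp_upto \<rho> k a"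
  have bij: "bij_betw (\<rho> k) Y Y" using Suc.prems by simp
  \<comment> \<open>\<open>b0\<close> is the only point from which the last step to \<open>b\<close>
    is forbidden, so the sum over predecessors misses exactly one term.\<close>
  obtain b0 where b0: "b0 \<in> Y" "\<rho> k b0 = b"
    using bij Suc.prems(2) by (metis bij_betw_imp_surj_on imageE)
  have set: "{b'\<in>Y. \<rho> k b' \<noteq> b} = Y - {b0}"
    using b0 bij by (auto simp: bij_betw_def inj_on_def)
  have d: "?d \<in> Y" using Suc.prems(1) assms(3) by (intro comp_upto_mem) auto
  have deq: "\<rho> k ?d = b \<longleftrightarrow> ?d = b0"
    using b0 d bij by (auto simp: bij_betw_def inj_on_def)
  have "int (card (walks (Suc k) Y ?R a b)) = (\<Sum>b'\<in>Y - {b0}. int (card (walks k Y ?R a b')))"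
    using card_walks_Suc[OF assms(1) Suc.prems(2), of k ?R a] by (simp add: set)
  also have "\<dots> = (\<Sum>b'\<in>Y - {b0}. walk_base ?p k + (-1) ^ k * of_bool (?d = b'))"
    using Suc by (intro sum.cong) auto
  also have "\<dots> = (\<Sum>b'\<in>Y. walk_base ?p k + (-1) ^ k * of_bool (?d = b')) -
      (walk_base ?p k + (-1) ^ k * of_bool (?d = b0))"
    using assms(1) b0(1) by (simp add: sum_diff1)
  also have "(\<Sum>b'\<in>Y. walk_base ?p k + (-1) ^ k * of_bool (?d = b')) = ?p * walk_base ?p k + (-1) ^ k"
    using assms(1) d by (simp add: sum.distrib sum_distrib_left[symmetric] of_bool_def sum.delta)
  finally show ?case by (simp add: deq algebra_simps)
qed

text \<open>Taking the trace: the all-ones part contributes \<open>p * walk_base p k\<close> with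
  \<open>p = card Y\<close>, the permutation part its number of fixed points with sign
  (-1)^k.\<close>

lemma card_closed_walks_avoiding:
  assumes "finite Y" "k > 0" "\<And>j. j < k \<Longrightarrow> bij_betw (\<rho> j) Y Y"
  shows "int (card (closed_walks k Y (\<lambda>j u v. \<rho> j u \<noteq> v))) =
    (int (card Y) - 1) ^ k - (-1) ^ k + (-1) ^ k * int (card {a\<in>Y. comp_upto \<rho> k a = a})"
proof -
  have "int (card (closed_walks k Y (\<lambda>j u v. \<rho> j u \<noteq> v))) =
      (\<Sum>a\<in>Y. walk_base (int (card Y)) k + (-1) ^ k * of_bool (comp_upto \<rho> k a = a))"
    using assms by (simp add: card_closed_walks card_walks_avoiding)
  also have "\<dots> = int (card Y) * walk_base (int (card Y)) k +
      (-1) ^ k * (\<Sum>a\<in>Y. of_bool (comp_upto \<rho> k a = a))"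
    by (simp add: sum.distrib sum_distrib_left)
  also have "(\<Sum>a\<in>Y. of_bool (comp_upto \<rho> k a = a)) = int (card {a\<in>Y. comp_upto \<rho> k a = a})"
    using assms(1) by (simp add: of_bool_def sum.If_cases Int_def)
  finally show ?thesis by (simp add: walk_base_closed_form)
qed

section \<open>Closed walks avoiding a point\<close>

text \<open>The permutation induced on the points other than \<open>x\<close>: \<open>x\<close> is
  deleted from its cycle, and its preimage is joined to its image.\<close>

definition bypass :: "'a \<Rightarrow> ('a \<Rightarrow> 'a) \<Rightarrow> 'a \<Rightarrow> 'a" where
  "bypass x \<pi> a = (if \<pi> a = x then \<pi> x else \<pi> a)"

lemma bij_betw_bypass:
  assumes "finite X" "bij_betw \<pi> X X" "x \<in> X"
  shows "bij_betw (bypass x \<pi>) (X - {x}) (X - {x})"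
proof -
  have inj: "inj_on \<pi> X" and img: "\<pi> ` X = X"
    using assms(2) by (auto simp: bij_betw_def)
  have "inj_on (bypass x \<pi>) (X - {x})"
    using inj assms(3) by (auto simp: inj_on_def bypass_def)
  moreover have "bypass x \<pi> ` (X - {x}) \<subseteq> X - {x}"
    using inj img assms(3) by (auto simp: inj_on_def bypass_def split: if_splits)
  ultimately show ?thesis
    using assms(1) by (simp add: bij_betw_def endo_inj_surj)
qed

text \<open>Between points other than \<open>x\<close>, the bypass keeps every step that
  \<open>\<pi> j\<close> forbids; it can only forbid more, namely steps from a preimage of
  \<open>x\<close> to the image of \<open>x\<close>.\<close>

lemma closed_walks_bypass_subset:
  "closed_walks k (X - {x}) (\<lambda>j a b. bypass x (\<pi> j) a \<noteq> b) \<subseteq> closed_walks k (X - {x}) (\<lambda>j a b. \<pi> j a \<noteq> b)"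
  by (rule closed_walks_mono) (auto simp: bypass_def split: if_splits)

section \<open>Lower bounds for one cycle and one color of the apex\<close>

text \<open>The chromatic polynomial of the cycle of length \<open>k\<close>, evaluated at
  \<open>p\<close>.\<close>

definition cycle_poly :: "nat \<Rightarrow> nat \<Rightarrow> int" where
  "cycle_poly k p = (int p - 1) ^ k + (-1) ^ k * (int p - 1)"

text \<open>For odd \<open>k\<close> the fixed points of the bypassed composition enter with a minus
  sign, so the count is smallest when all \<open>p\<close> points are fixed, where it equals
  \<open>cycle_poly k p\<close>.\<close>

lemma card_closed_walks_odd_ge:
  assumes X: "finite X" "card X = Suc p" "x \<in> X" and "odd k"
    and \<pi>: "\<And>j. j < k \<Longrightarrow> bij_betw (\<pi> j) X X"
  shows "cycle_poly k p \<le> int (card (closed_walks k (X - {x}) (\<lambda>j a b. \<pi> j a \<noteq> b)))"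
proof -
  let ?Y = "X - {x}" and ?\<rho> = "\<lambda>j. bypass x (\<pi> j)"
  have k: "k > 0" using \<open>odd k\<close> by (cases k) auto
  have cardY: "card ?Y = p" using X by simp
  have "card {a\<in>?Y. comp_upto ?\<rho> k a = a} \<le> card ?Y"
    using X by (intro card_mono) auto
  moreover have "int (card (closed_walks k ?Y (\<lambda>j a b. ?\<rho> j a \<noteq> b))) =
      (int p - 1) ^ k + 1 - int (card {a\<in>?Y. comp_upto ?\<rho> k a = a})"
    using card_closed_walks_avoiding[OF _ k bij_betw_bypass, of X x \<pi>] X \<pi> \<open>odd k\<close> cardY by simp
  ultimately have "cycle_poly k p \<le> int (card (closed_walks k ?Y (\<lambda>j a b. ?\<rho> j a \<noteq> b)))"
    using \<open>odd k\<close> cardY by (simp add: cycle_poly_def)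
  also have "\<dots> \<le> int (card (closed_walks k ?Y (\<lambda>j a b. \<pi> j a \<noteq> b)))"
    using X by (intro of_nat_mono card_mono finite_closed_walks closed_walks_bypass_subset) auto
  finally show ?thesis .
qed

text \<open>For even \<open>k\<close> every fixed point of the bypassed composition adds one walk.
  Points of \<open>F\<close> other than \<open>x\<close> stay fixed, as no bypass changes their
  images.\<close>

lemma card_closed_walks_even_ge:
  assumes X: "finite X" "card X = Suc p" "x \<in> X" and "even k" "k > 0"
    and \<pi>: "\<And>j. j < k \<Longrightarrow> bij_betw (\<pi> j) X X"
    and fixed: "F \<subseteq> X" "\<And>a j. a \<in> F \<Longrightarrow> j < k \<Longrightarrow> \<pi> j a = a"
  shows "(int p - 1) ^ k - 1 + int (card (F - {x})) \<le>
    int (card (closed_walks k (X - {x}) (\<lambda>j a b. \<pi> j a \<noteq> b)))"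
proof -
  let ?Y = "X - {x}" and ?\<rho> = "\<lambda>j. bypass x (\<pi> j)"
  have cardY: "card ?Y = p" using X by simp
  have "comp_upto ?\<rho> k a = a" if "a \<in> F - {x}" for a
    using fixed that by (intro comp_upto_fixed) (auto simp: bypass_def)
  then have "card (F - {x}) \<le> card {a\<in>?Y. comp_upto ?\<rho> k a = a}"
    using X fixed(1) by (intro card_mono) auto
  moreover have "int (card (closed_walks k ?Y (\<lambda>j a b. ?\<rho> j a \<noteq> b))) =
      (int p - 1) ^ k - 1 + int (card {a\<in>?Y. comp_upto ?\<rho> k a = a})"
    using card_closed_walks_avoiding[OF _ \<open>k > 0\<close> bij_betw_bypass, of X x \<pi>] X \<pi> \<open>even k\<close> cardY by simp
  ultimately have "(int p - 1) ^ k - 1 + int (card (F - {x})) \<le>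
      int (card (closed_walks k ?Y (\<lambda>j a b. ?\<rho> j a \<noteq> b)))"
    by simp
  also have "\<dots> \<le> int (card (closed_walks k ?Y (\<lambda>j a b. \<pi> j a \<noteq> b)))"
    using X by (intro of_nat_mono card_mono finite_closed_walks closed_walks_bypass_subset) auto
  finally show ?thesis .
qed

text \<open>
  Besides the walks avoiding the bypassed permutations, there are those that use the step from
  the \<open>\<pi> k\<close>-preimage \<open>z\<close> of \<open>x\<close> to its image \<open>y\<close>, which the bypass forbids. Their number drops by one
  only if the composition maps \<open>y\<close> to itself, which then is an additional fixed point outside \<open>F\<close>.
\<close>

lemma card_closed_walks_even_last_moved:
  assumes X: "finite X" "card X = Suc p" "x \<in> X" and "even (Suc k)"
    and \<pi>: "\<And>j. j < Suc k \<Longrightarrow> bij_betw (\<pi> j) X X"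
    and fixed: "F \<subseteq> X" "\<And>a j. a \<in> F \<Longrightarrow> j < Suc k \<Longrightarrow> \<pi> j a = a"
    and moved: "\<pi> k x \<noteq> x"
  shows "(int p - 1) ^ Suc k - 1 + walk_base (int p) k + int (card F) \<le>
    int (card (closed_walks (Suc k) (X - {x}) (\<lambda>j a b. \<pi> j a \<noteq> b)))"
proof -
  let ?Y = "X - {x}" and ?\<rho> = "\<lambda>j. bypass x (\<pi> j)"
  let ?R = "\<lambda>j a b. ?\<rho> j a \<noteq> b" and ?S = "\<lambda>j a b. \<pi> j a \<noteq> b"
  let ?f = "{a\<in>?Y. comp_upto ?\<rho> (Suc k) a = a}"
  have cardY: "card ?Y = p" and finY: "finite ?Y" using X by simp_all
  have inj: "inj_on (\<pi> k) X" and img: "\<pi> k ` X = X"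
    using \<pi>[of k] by (auto simp: bij_betw_def)
  obtain z where z: "z \<in> X" "\<pi> k z = x" using img X(3) by (metis imageE)
  define y where "y = \<pi> k x"
  have zY: "z \<in> ?Y" using z moved by auto
  have yY: "y \<in> ?Y" using moved img X(3) by (auto simp: y_def)
  have \<rho>z: "?\<rho> k z = y" using z by (simp add: bypass_def y_def)
  have xF: "x \<notin> F" using fixed(2)[of x k] moved by auto
  have yF: "y \<notin> F"
  proof
    assume "y \<in> F"
    then have "\<pi> k y = \<pi> k x" using fixed(2)[of y k] by (simp add: y_def)
    then show False using inj X(3) yY by (auto simp: inj_on_def)
  qed
  have Ffix: "comp_upto ?\<rho> (Suc k) a = a" if "a \<in> F" for a
    using fixed(2) that xF by (intro comp_upto_fixed) (auto simp: bypass_def)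
  have Fsub: "F \<subseteq> ?f" using Ffix xF fixed(1) by auto
  have f_ge: "int (card F) + of_bool (comp_upto ?\<rho> k y = z) \<le> int (card ?f)"
  proof (cases "comp_upto ?\<rho> k y = z")
    case True
    then have "insert y F \<subseteq> ?f" using Fsub yY \<rho>z by auto
    then have "card (insert y F) \<le> card ?f" using finY by (intro card_mono) auto
    then show ?thesis using True yF fixed(1) X(1) by (simp add: finite_subset)
  next
    case False
    have "card F \<le> card ?f" using finY Fsub by (intro card_mono) auto
    with False show ?thesis by simp
  qed
  \<comment> \<open>\<open>k\<close> is odd here, which makes the permutation term negative.\<close>
  have walks_eq: "int (card (walks k ?Y ?R y z)) =
      walk_base (int p) k - of_bool (comp_upto ?\<rho> k y = z)"
    using card_walks_avoiding[OF finY bij_betw_bypass yY zY, of k \<pi>] X \<pi> \<open>even (Suc k)\<close> cardY by simp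
  have closed_eq: "int (card (closed_walks (Suc k) ?Y ?R)) = (int p - 1) ^ Suc k - 1 + int (card ?f)"
    using card_closed_walks_avoiding[OF finY _ bij_betw_bypass, of "Suc k" \<pi>] X \<pi> \<open>even (Suc k)\<close> cardY
    by simp
  \<comment> \<open>The positions \<open>{..k}\<close> are those of a closed walk of length
    \<open>Suc k\<close>. Its closing step leads from \<open>z\<close> to \<open>y\<close>, which
    \<open>\<pi> k\<close> permits because it maps \<open>z\<close> to \<open>x\<close>.\<close>
  have "walks k ?Y ?R y z \<subseteq> closed_walks (Suc k) ?Y ?S"
  proof
    fix e assume e: "e \<in> walks k ?Y ?R y z"
    then have mem: "e j \<in> ?Y" if "j \<le> k" for j
      using that by (auto simp: walks_def)
    have "\<pi> j (e j) \<noteq> e (Suc j mod Suc k)" if "j < Suc k" for j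
    proof (cases "j = k")
      case True
      then show ?thesis using e z(2) yY by (auto simp: walks_def)
    next
      case False
      then have "Suc j mod Suc k = Suc j" "?\<rho> j (e j) \<noteq> e (Suc j)" "e (Suc j) \<noteq> x"
        using that e mem[of "Suc j"] by (auto simp: walks_def)
      then show ?thesis by (auto simp: bypass_def split: if_splits)
    qed
    moreover have "e \<in> {..<Suc k} \<rightarrow>\<^sub>E ?Y"
      using e by (simp add: walks_def lessThan_Suc_atMost)
    ultimately show "e \<in> closed_walks (Suc k) ?Y ?S" by (simp add: closed_walks_def)
  qed
  then have sub: "closed_walks (Suc k) ?Y ?R \<union> walks k ?Y ?R y z \<subseteq> closed_walks (Suc k) ?Y ?S"
    by (intro Un_least closed_walks_bypass_subset)
  have disj: "closed_walks (Suc k) ?Y ?R \<inter> walks k ?Y ?R y z = {}"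
  proof (rule equals0I)
    fix e assume "e \<in> closed_walks (Suc k) ?Y ?R \<inter> walks k ?Y ?R y z"
    then have "\<forall>j<Suc k. ?\<rho> j (e j) \<noteq> e (Suc j mod Suc k)" "e k = z" "e 0 = y"
      by (auto simp: closed_walks_def walks_def)
    then show False using \<rho>z by (auto dest: spec[of _ k])
  qed
  have "card (closed_walks (Suc k) ?Y ?R) + card (walks k ?Y ?R y z) =
      card (closed_walks (Suc k) ?Y ?R \<union> walks k ?Y ?R y z)"
    by (rule card_Un_disjoint[OF finite_closed_walks[OF finY] finite_walks[OF finY] disj, symmetric])
  also have "\<dots> \<le> card (closed_walks (Suc k) ?Y ?S)"
    using finY sub by (intro card_mono finite_closed_walks)
  finally show ?thesis using closed_eq walks_eq f_ge by linarith
qed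

text \<open>A rotation carries an index at which \<open>x\<close> is moved to the last position. The
  hypothesis on \<open>F\<close> concerns all indices and is preserved.\<close>

lemma card_closed_walks_even_moved:
  assumes X: "finite X" "card X = Suc p" "x \<in> X" and "even k"
    and \<pi>: "\<And>j. j < k \<Longrightarrow> bij_betw (\<pi> j) X X"
    and fixed: "F \<subseteq> X" "\<And>a j. a \<in> F \<Longrightarrow> j < k \<Longrightarrow> \<pi> j a = a"
    and moved: "i < k" "\<pi> i x \<noteq> x"
  shows "(int p - 1) ^ k - 1 + walk_base (int p) (k - 1) + int (card F) \<le>
    int (card (closed_walks k (X - {x}) (\<lambda>j a b. \<pi> j a \<noteq> b)))"
proof -
  obtain l where l: "k = Suc l" using moved(1) by (cases k) auto
  let ?\<pi> = "\<lambda>j. \<pi> ((j + Suc i) mod k)"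
  \<comment> \<open>The shift by \<open>Suc i\<close> sends the last index \<open>l = k - 1\<close>
    to \<open>k + i\<close>, hence to \<open>i\<close>.\<close>
  have "(l + Suc i) mod k = i" using l moved(1) by (metis add_Suc_shift mod_add_self1 mod_less)
  then have "(int p - 1) ^ k - 1 + walk_base (int p) (k - 1) + int (card F) \<le>
      int (card (closed_walks k (X - {x}) (\<lambda>j a b. ?\<pi> j a \<noteq> b)))"
    using card_closed_walks_even_last_moved[of X p x l ?\<pi> F] assms l by simp
  also have "\<dots> \<le> int (card (closed_walks k (X - {x}) (\<lambda>j a b. \<pi> j a \<noteq> b)))"
    using card_closed_walks_rotate_le[of "X - {x}" "Suc i" k "\<lambda>j a b. \<pi> j a \<noteq> b"] X moved(1) by simp
  finally show ?thesis .
qed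

section \<open>The product over the colors of the apex\<close>

lemma cycle_poly_pos:
  assumes "p \<ge> 3" "k \<ge> 2"
  shows "cycle_poly k p > 0"
proof -
  let ?q = "int p - 1"
  have "?q < ?q ^ 2" using assms(1) by (simp add: power2_eq_square)
  also have "?q ^ 2 \<le> ?q ^ k" using assms by (intro power_increasing) auto
  finally have "?q < ?q ^ k" .
  then show ?thesis using assms(1) by (cases "even k") (auto simp: cycle_poly_def)
qed

text \<open>The bound makes the surplus \<open>walk_base p k - p\<close> at least
  \<open>p - 1\<close>. Equality holds for \<open>p = 4\<close> and \<open>k = 3\<close>.\<close>

lemma walk_base_ge:
  fixes p :: int
  assumes "p \<ge> 4" "odd k" "k \<ge> 3"
  shows "walk_base p k \<ge> 2 * p - 1"
proof -
  \<comment> \<open>The product equals \<open>(p - 1) ^ 3 + 1 - p * (2 * p - 1)\<close>.\<close>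
  have "p * (p - 1) * (p - 4) \<ge> 0" using assms(1) by simp
  then have "p * (2 * p - 1) \<le> (p - 1) ^ 3 + 1" by (simp add: power3_eq_cube algebra_simps)
  also have "\<dots> \<le> (p - 1) ^ k + 1"
    using assms by (intro add_right_mono power_increasing) auto
  also have "\<dots> = p * walk_base p k" using assms(2) by (simp add: walk_base_closed_form)
  finally show ?thesis using assms(1) by simp
qed

text \<open>After division by \<open>P ^ (s + t)\<close>, Bernoulli's inequality bounds both powers
  from below by linear terms; the last assumption makes the product of these at least 1.\<close>

lemma power_mult_power_ge_by_Bernoulli:
  fixes P q :: real and s t :: nat
  assumes "P > 0" "real t \<le> P" "q \<ge> 0" "real s * real t * (q + real s) \<le> P * q"
  shows "P ^ (s + t) \<le> (P - real t) ^ s * (P + (q + real s)) ^ t"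
proof (cases "t = 0")
  case True
  then show ?thesis by simp
next
  case False
  define g where "g = q + real s"
  have g: "g \<ge> 0" using assms(3) by (simp add: g_def)
  have a: "1 - real s * real t / P \<le> (1 - real t / P) ^ s"
    using Bernoulli_inequality[of "- real t / P" s] assms(1,2) by (simp add: field_simps)
  have b: "1 + real t * g / P \<le> (1 + g / P) ^ t"
    using Bernoulli_inequality[of "g / P" t] assms(1) g
    by (smt (verit) divide_nonneg_nonneg times_divide_eq_right)
  \<comment> \<open>Since g - s = q, the difference of the two sides is t (P q - s t g) /
    P^2.\<close>
  have key: "1 \<le> (1 - real s * real t / P) * (1 + real t * g / P)"
  proof -
    have "real s * real t * g \<le> P * (g - real s)" using assms(4) by (simp add: g_def)
    then have "real t * (real s * real t * g) \<le> real t * (P * (g - real s))"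
      by (rule mult_left_mono) simp
    then have "0 \<le> (real t * (P * (g - real s)) - real t * (real s * real t * g)) / P\<^sup>2"
      by simp
    also have "\<dots> = (1 - real s * real t / P) * (1 + real t * g / P) - 1"
      using assms(1) by (simp add: field_simps power2_eq_square)
    finally show ?thesis by simp
  qed
  have "1 \<le> (1 - real t / P) ^ s * (1 + g / P) ^ t"
  proof -
    have "(1 - real s * real t / P) * (1 + real t * g / P) \<le> (1 - real t / P) ^ s * (1 + real t * g / P)"
      using a g assms(1) by (intro mult_right_mono) auto
    also have "\<dots> \<le> (1 - real t / P) ^ s * (1 + g / P) ^ t"
      using b assms(1,2) by (intro mult_left_mono zero_le_power) auto
    finally show ?thesis using key by simp
  qed
  then have "P ^ (s + t) * 1 \<le> P ^ (s + t) * ((1 - real t / P) ^ s * (1 + g / P) ^ t)"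
    using assms(1) by (intro mult_left_mono) auto
  also have "\<dots> = (P * (1 - real t / P)) ^ s * (P * (1 + g / P)) ^ t"
    by (simp add: power_add power_mult_distrib)
  also have "P * (1 - real t / P) = P - real t" using assms(1) by (simp add: field_simps)
  also have "P * (1 + g / P) = P + g" using assms(1) by (simp add: field_simps)
  finally show ?thesis by (simp add: g_def)
qed

text \<open>For odd \<open>k\<close> each factor is at least \<open>?P\<close>. For even
  \<open>k\<close> single factors may be smaller, and the gains at moved points must outweigh the
  losses at points fixed by all permutations.\<close>

lemma prod_closed_walks_ge:
  assumes X: "finite X" "card X = Suc p" and "p \<ge> 4" "k \<ge> 3"
    and \<pi>: "\<And>j. j < k \<Longrightarrow> bij_betw (\<pi> j) X X"
  shows "real_of_int (cycle_poly k p) ^ Suc p \<le>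
    (\<Prod>x\<in>X. real (card (closed_walks k (X - {x}) (\<lambda>j a b. \<pi> j a \<noteq> b))))"
    (is "?P ^ _ \<le> (\<Prod>x\<in>X. real (?N x))")
proof (cases "odd k")
  case True
  have "?P \<le> real (?N x)" if "x \<in> X" for x
    using card_closed_walks_odd_ge[OF X that True, of \<pi>] \<pi> by force
  moreover have "?P > 0" using cycle_poly_pos[of p k] assms by simp
  ultimately have "(\<Prod>x\<in>X. ?P) \<le> (\<Prod>x\<in>X. real (?N x))"
    by (intro prod_mono) auto
  then show ?thesis using X by simp
next
  case False
  then have "even k" by simp
  then have k: "k \<ge> 4" using \<open>k \<ge> 3\<close> by (cases "k = 3") auto
  define F where "F = {a\<in>X. \<forall>j<k. \<pi> j a = a}"
  define s where "s = card F"
  define t where "t = card (X - F)"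
  have F: "F \<subseteq> X" "\<And>a j. a \<in> F \<Longrightarrow> j < k \<Longrightarrow> \<pi> j a = a" by (auto simp: F_def)
  have finF: "finite F" using F(1) X(1) finite_subset by blast
  have "s + t = card X"
    unfolding s_def t_def using F(1) X(1) by (simp add: card_Diff_subset finF card_mono)
  then have st: "s + t = Suc p" using X(2) by simp
  \<comment> \<open>The gain of a moved point beyond \<open>real s\<close>: its lower bound starts
    from \<open>(p - 1) ^ k - 1\<close>, which is \<open>?P - p\<close>.\<close>
  define q where "q = real_of_int (walk_base (int p) (k - 1)) - real p"
  have P: "?P = (real p - 1) ^ k + real p - 1" using \<open>even k\<close> by (simp add: cycle_poly_def)
  have N_fixed: "?P - real t \<le> real (?N x)" if "x \<in> F" for x
  proof -
    \<comment> \<open>Removing \<open>x\<close> leaves \<open>s - 1 = p - t\<close> points of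
      \<open>F\<close>; the bound for even \<open>k\<close> then becomes
      \<open>?P - t\<close>.\<close>
    have "card (F - {x}) = s - 1" "s > 0"
      using that finF by (auto simp: s_def card_gt_0_iff)
    then have "int (card (F - {x})) = int p - int t" using st by linarith
    moreover have "(int p - 1) ^ k - 1 + int (card (F - {x})) \<le> int (?N x)"
      by (rule card_closed_walks_even_ge) (use X \<pi> F \<open>even k\<close> k that in auto)
    ultimately have "cycle_poly k p - int t \<le> int (?N x)"
      using \<open>even k\<close> by (simp add: cycle_poly_def)
    then show ?thesis by linarith
  qed
  have N_moved: "?P + (q + real s) \<le> real (?N x)" if "x \<in> X - F" for x
  proof -
    obtain i where i: "i < k" "\<pi> i x \<noteq> x" using \<open>x \<in> X - F\<close> by (auto simp: F_def)
    have "(int p - 1) ^ k - 1 + walk_base (int p) (k - 1) + int (card F) \<le> int (?N x)"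
      by (rule card_closed_walks_even_moved[where i = i]) (use X \<pi> F \<open>even k\<close> i that in auto)
    then have "cycle_poly k p + (walk_base (int p) (k - 1) - int p + int s) \<le> int (?N x)"
      using \<open>even k\<close> by (simp add: cycle_poly_def s_def)
    then show ?thesis unfolding q_def by linarith
  qed
  have "walk_base (int p) (k - 1) \<ge> 2 * int p - 1"
    using \<open>even k\<close> k \<open>p \<ge> 4\<close> by (intro walk_base_ge) auto
  then have q: "q \<ge> real p - 1" unfolding q_def by linarith
  have "3 ^ 2 * (real p - 1) ^ 2 \<le> (real p - 1) ^ 2 * (real p - 1) ^ 2"
    using \<open>p \<ge> 4\<close> by (intro mult_right_mono power_mono) auto
  also have "\<dots> = (real p - 1) ^ 4" by (simp add: power_add[symmetric])
  also have "\<dots> \<le> (real p - 1) ^ k"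
    using k \<open>p \<ge> 4\<close> by (intro power_increasing) auto
  finally have big: "9 * (real p - 1) ^ 2 \<le> (real p - 1) ^ k" by simp
  \<comment> \<open>The right side is a third of neither bound but their difference
    \<open>9 * (p - 1) ^ 2 - 3 * (p * (p + 1))\<close>.\<close>
  have "0 \<le> 6 * (real p - 4) * real p + 3 * real p + 9" using \<open>p \<ge> 4\<close> by simp
  then have "3 * (real p * (real p + 1)) \<le> 9 * (real p - 1) ^ 2"
    by (simp add: power2_eq_square algebra_simps)
  with big have P_ge: "3 * (real p * (real p + 1)) \<le> ?P"
    using P \<open>p \<ge> 4\<close> by linarith
  have prods: "?P ^ (s + t) \<le> (?P - real t) ^ s * (?P + (q + real s)) ^ t"
  proof (cases "t = 0")
    case True
    then show ?thesis by simp
  next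
    case False
    have sp: "real s \<le> real p" and tp: "real t \<le> real p + 1" using st False by auto
    have pp: "real p + 1 \<le> real p * (real p + 1)" using \<open>p \<ge> 4\<close> by simp
    show ?thesis
    proof (rule power_mult_power_ge_by_Bernoulli)
      show "?P > 0" using cycle_poly_pos[of p k] assms by simp
      show "real t \<le> ?P" using tp pp P_ge by linarith
      show "0 \<le> q" using q \<open>p \<ge> 4\<close> by linarith
      have "real s * real t \<le> real p * (real p + 1)"
        using sp tp by (intro mult_mono) auto
      \<comment> \<open>Here \<open>s \<le> p \<le> q + 1 \<le> 2 * q\<close>. The resulting factor
        3 is the one provided by \<open>P_ge\<close>.\<close>
      moreover have "q + real s \<le> 3 * q" using q sp \<open>p \<ge> 4\<close> by linarith
      ultimately have "real s * real t * (q + real s) \<le> real p * (real p + 1) * (3 * q)"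
        by (rule mult_mono) (use \<open>0 \<le> q\<close> in auto)
      also have "\<dots> = 3 * (real p * (real p + 1)) * q" by simp
      also have "\<dots> \<le> ?P * q" using P_ge \<open>0 \<le> q\<close> by (rule mult_right_mono)
      finally show "real s * real t * (q + real s) \<le> ?P * q" .
    qed
  qed
  have tP: "real t \<le> ?P"
  proof -
    have "real t \<le> real p + 1" using st by linarith
    also have "\<dots> \<le> real p * (real p + 1)" using \<open>p \<ge> 4\<close> by simp
    finally show ?thesis using P_ge by linarith
  qed
  have "(?P - real t) ^ s * (?P + (q + real s)) ^ t =
      (\<Prod>x\<in>F. ?P - real t) * (\<Prod>x\<in>X - F. ?P + (q + real s))"
    by (simp add: s_def t_def)
  also have "\<dots> \<le> (\<Prod>x\<in>F. real (?N x)) * (\<Prod>x\<in>X - F. real (?N x))"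
  proof (intro mult_mono prod_mono conjI)
    have "0 \<le> ?P + (q + real s)" using q \<open>p \<ge> 4\<close> tP by linarith
    then show "0 \<le> ?P + (q + real s)" "0 \<le> (\<Prod>x\<in>X - F. ?P + (q + real s))"
      by (auto intro: prod_nonneg)
  qed (use N_fixed N_moved tP in \<open>auto intro: prod_nonneg\<close>)
  also have "\<dots> = (\<Prod>x\<in>X. real (?N x))"
    using prod.subset_diff[OF F(1) X(1), of "\<lambda>x. real (?N x)"] by (simp add: mult.commute)
  finally show ?thesis using prods st by simp
qed

section \<open>Combining the cycles\<close>

text \<open>The inequality of arithmetic and geometric means for the ratios \<open>y x\<close>,
  proved by \<open>ln y \<le> y - 1\<close>: interchanging the products shows that the product of
  all \<open>y x\<close> is at least 1, so their sum is at least \<open>card X\<close>.\<close>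

lemma sum_prod_ge_of_prod_ge:
  fixes N :: "'i \<Rightarrow> 'a \<Rightarrow> real" and P :: "'i \<Rightarrow> real"
  assumes "finite I" "finite X" and P: "\<And>i. i \<in> I \<Longrightarrow> P i > 0"
    and N: "\<And>i x. i \<in> I \<Longrightarrow> x \<in> X \<Longrightarrow> N i x \<ge> 0"
    and prod: "\<And>i. i \<in> I \<Longrightarrow> P i ^ card X \<le> (\<Prod>x\<in>X. N i x)"
  shows "real (card X) * (\<Prod>i\<in>I. P i) \<le> (\<Sum>x\<in>X. \<Prod>i\<in>I. N i x)"
proof -
  define y where "y x = (\<Prod>i\<in>I. N i x / P i)" for x
  \<comment> \<open>Logarithms require positive entries; a zero entry would make the product over
    \<open>X\<close> vanish.\<close>
  have N_pos: "N i x > 0" if "i \<in> I" "x \<in> X" for i x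
  proof (rule ccontr)
    assume "\<not> N i x > 0"
    then have "N i x = 0" using N that by force
    then have "(\<Prod>x\<in>X. N i x) = 0" using assms(2) that by auto
    moreover have "P i ^ card X > 0" using P that by simp
    ultimately show False using prod[OF that(1)] by simp
  qed
  have y_pos: "y x > 0" if "x \<in> X" for x
    unfolding y_def using N_pos P that by (intro prod_pos) auto
  have "1 \<le> (\<Prod>i\<in>I. (\<Prod>x\<in>X. N i x) / P i ^ card X)"
    using P prod by (intro prod_ge_1) simp
  also have "\<dots> = (\<Prod>x\<in>X. y x)"
    unfolding y_def by (subst prod.swap) (simp add: prod_dividef)
  finally have "0 \<le> ln (\<Prod>x\<in>X. y x)" by simp
  also have "\<dots> = (\<Sum>x\<in>X. ln (y x))" using assms(2) y_pos less_irrefl by (metis ln_prod)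
  also have "\<dots> \<le> (\<Sum>x\<in>X. y x - 1)"
    using y_pos by (intro sum_mono ln_le_minus_one)
  finally have "real (card X) \<le> (\<Sum>x\<in>X. y x)" by (simp add: sum_subtractf)
  then have "real (card X) * (\<Prod>i\<in>I. P i) \<le> (\<Sum>x\<in>X. y x) * (\<Prod>i\<in>I. P i)"
    using P by (intro mult_right_mono prod_nonneg) (auto intro: less_imp_le)
  also have "\<dots> = (\<Sum>x\<in>X. \<Prod>i\<in>I. N i x)"
    unfolding sum_distrib_right y_def prod.distrib[symmetric]
    using P by (intro sum.cong prod.cong) (auto simp: less_imp_neq[THEN not_sym])
  finally show ?thesis .
qed

lemma sum_prod_closed_walks_ge:
  assumes X: "finite X" "card X = Suc p" and "p \<ge> 4" "finite I" "\<And>i. i \<in> I \<Longrightarrow> k i \<ge> 3"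
    and \<pi>: "\<And>i j. i \<in> I \<Longrightarrow> j < k i \<Longrightarrow> bij_betw (\<pi> i j) X X"
  shows "int (Suc p) * (\<Prod>i\<in>I. cycle_poly (k i) p) \<le>
    int (\<Sum>x\<in>X. \<Prod>i\<in>I. card (closed_walks (k i) (X - {x}) (\<lambda>j a b. \<pi> i j a \<noteq> b)))"
proof -
  have "real (card X) * (\<Prod>i\<in>I. real_of_int (cycle_poly (k i) p)) \<le>
      (\<Sum>x\<in>X. \<Prod>i\<in>I. real (card (closed_walks (k i) (X - {x}) (\<lambda>j a b. \<pi> i j a \<noteq> b))))"
  proof (rule sum_prod_ge_of_prod_ge)
    fix i assume i: "i \<in> I"
    have "k i \<ge> 3" using assms(5) i by simp
    then show "real_of_int (cycle_poly (k i) p) > 0"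
      using cycle_poly_pos[of p "k i"] \<open>p \<ge> 4\<close> by simp
    show "real_of_int (cycle_poly (k i) p) ^ card X \<le>
        (\<Prod>x\<in>X. real (card (closed_walks (k i) (X - {x}) (\<lambda>j a b. \<pi> i j a \<noteq> b))))"
      using prod_closed_walks_ge[OF X \<open>p \<ge> 4\<close> \<open>k i \<ge> 3\<close>, of "\<pi> i"] \<pi> i X by simp
  qed (use assms in auto)
  also have "\<dots> = real_of_int (int (\<Sum>x\<in>X. \<Prod>i\<in>I. card (closed_walks (k i) (X - {x}) (\<lambda>j a b. \<pi> i j a \<noteq> b))))"
    by simp
  finally have "real_of_int (int (Suc p) * (\<Prod>i\<in>I. cycle_poly (k i) p)) \<le> \<dots>"
    using X by simp
  then show ?thesis by (simp only: of_int_le_iff)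
qed

text \<open>Identity permutations attain the lower bound: their composition fixes all
  \<open>p\<close> points of \<open>X - {x}\<close>.\<close>

lemma sum_prod_closed_walks_id:
  assumes X: "finite X" "card X = Suc p" and "\<And>i. i \<in> I \<Longrightarrow> k i > 0"
  shows "int (\<Sum>x\<in>X. \<Prod>i\<in>I. card (closed_walks (k i) (X - {x}) (\<lambda>j a b. a \<noteq> b))) =
    int (Suc p) * (\<Prod>i\<in>I. cycle_poly (k i) p)"
proof -
  have "int (card (closed_walks (k i) (X - {x}) (\<lambda>j a b. a \<noteq> b))) = cycle_poly (k i) p"
    if "x \<in> X" "i \<in> I" for x i
  proof -
    have "comp_upto (\<lambda>_. id) l a = a" for l and a :: 'a by (rule comp_upto_fixed) simp
    moreover have "card {a \<in> X. a \<noteq> x} = p"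
    proof -
      have "{a \<in> X. a \<noteq> x} = X - {x}" by auto
      then show ?thesis using X that by simp
    qed
    ultimately show ?thesis
      using card_closed_walks_avoiding[of "X - {x}" "k i" "\<lambda>_. id"] X assms(3) that
      by (simp add: cycle_poly_def algebra_simps)
  qed
  then show ?thesis using X by simp
qed

section \<open>Covers and transversals\<close>

text \<open>The unmatched parts of \<open>A\<close> and \<open>B\<close> have equal size, so any
  bijection between them completes the matching. Perfect matchings forbid at least as much as the
  given ones, which is harmless for a lower bound on colorings.\<close>

lemma partial_matching_extends_to_bij:
  assumes "finite A" "finite B" "card A = card B"
    and right_unique: "\<And>x y y'. x \<in> A \<Longrightarrow> y \<in> B \<Longrightarrow> y' \<in> B \<Longrightarrow> r x y \<Longrightarrow> r x y' \<Longrightarrow> y = y'"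
    and left_unique: "\<And>x x' y. x \<in> A \<Longrightarrow> x' \<in> A \<Longrightarrow> y \<in> B \<Longrightarrow> r x y \<Longrightarrow> r x' y \<Longrightarrow> x = x'"
  shows "\<exists>f. bij_betw f A B \<and> (\<forall>x\<in>A. \<forall>y\<in>B. r x y \<longrightarrow> f x = y)"
proof -
  define D where "D = {x\<in>A. \<exists>y\<in>B. r x y}"
  have "\<forall>x\<in>D. \<exists>y. y \<in> B \<and> r x y" by (auto simp: D_def)
  then obtain f where f: "\<And>x. x \<in> D \<Longrightarrow> f x \<in> B \<and> r x (f x)" using bchoice by metis
  have "D \<subseteq> A" by (auto simp: D_def)
  have "f ` D \<subseteq> B" using f by auto
  have injf: "inj_on f D"
    using f \<open>D \<subseteq> A\<close> by (intro inj_onI) (metis left_unique subsetD)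
  have "card (A - D) = card (B - f ` D)"
    using assms(1-3) \<open>D \<subseteq> A\<close> \<open>f ` D \<subseteq> B\<close> injf
    by (simp add: card_Diff_subset finite_subset card_image)
  then obtain g where g: "bij_betw g (A - D) (B - f ` D)"
    using assms(1,2) by (metis finite_Diff finite_same_card_bij)
  let ?h = "\<lambda>x. if x \<in> D then f x else g x"
  have "bij_betw ?h (D \<union> (A - D)) (f ` D \<union> (B - f ` D))"
    using injf g by (intro bij_betw_disjoint_Un) (auto simp: bij_betw_def)
  then have "bij_betw ?h A B"
    using \<open>D \<subseteq> A\<close> \<open>f ` D \<subseteq> B\<close> by (simp add: Un_absorb1)
  moreover have "?h x = y" if "x \<in> A" "y \<in> B" "r x y" for x y
  proof -
    have "x \<in> D" using that by (auto simp: D_def)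
    then show ?thesis using f[of x] right_unique that by auto
  qed
  ultimately show ?thesis by blast
qed

text \<open>The cardinality condition in \<open>cover\<close> makes \<open>L\<close> injective, so
  different vertices have different parts of the partition.\<close>

lemma cover_disjoint:
  assumes "simple_graph G" "cover G L H" "u \<in> verts G" "v \<in> verts G" "u \<noteq> v"
  shows "L u \<inter> L v = {}"
proof -
  have "finite (verts G)" using assms(1) by (simp add: simple_graph_def)
  then have "inj_on L (verts G)" using assms(2) by (auto simp: cover_def intro: eq_card_imp_inj_on)
  then have "L u \<noteq> L v" using assms by (auto simp: inj_on_def)
  then show ?thesis using assms by (auto simp: cover_def partition_on_def disjoint_def)
qed

lemma cover_lists:
  assumes "cover G L H"
  shows "verts H = (\<Union>u\<in>verts G. L u)"
  using assms by (auto simp: cover_def partition_on_def)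

text \<open>Colorings as choice functions, which can be built and counted vertex by vertex.\<close>

definition transversals :: "'a sgraph \<Rightarrow> ('a \<Rightarrow> 'b set) \<Rightarrow> 'b sgraph \<Rightarrow> ('a \<Rightarrow> 'b) set" where
  "transversals G L H = {c \<in> PiE (verts G) L. \<forall>u v. {u, v} \<in> edges G \<longrightarrow> {c u, c v} \<notin> edges H}"

lemma finite_transversals:
  assumes "simple_graph G" "cover G L H"
  shows "finite (transversals G L H)"
proof -
  have "finite (verts H)" "finite (verts G)"
    using assms by (auto simp: cover_def simple_graph_def)
  then have "finite (PiE (verts G) L)"
    using cover_lists[OF assms(2)] by (intro finite_PiE) auto
  then show ?thesis by (rule rev_finite_subset) (auto simp: transversals_def)
qed

text \<open>Lists are cliques, so an independent set meets each list at most once and, by its size,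
  exactly once.\<close>

lemma card_cover_colorings:
  assumes G: "simple_graph G" and cov: "cover G L H"
  shows "card (cover_colorings G H) = card (transversals G L H)"
proof -
  let ?V = "verts G"
  have disj: "u = v" if "u \<in> ?V" "v \<in> ?V" "x \<in> L u" "x \<in> L v" for u v x
    using cover_disjoint[OF G cov] that by blast
  have finV: "finite ?V" using G by (simp add: simple_graph_def)
  have edge2: "card e = 2" if "e \<in> edges H" for e
    using cov that by (auto simp: cover_def simple_graph_def)
  have "inj_on (\<lambda>c. c ` ?V) (transversals G L H)"
  proof (rule inj_onI)
    fix c c' assume c: "c \<in> transversals G L H" and c': "c' \<in> transversals G L H"
      and eq: "c ` ?V = c' ` ?V"
    have "c u = c' u" if u: "u \<in> ?V" for u
    proof -
      obtain v where v: "v \<in> ?V" "c u = c' v" using eq u by (metis image_iff)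
      then have "u = v"
        using c c' u by (intro disj[of u v "c u"]) (auto simp: transversals_def PiE_def Pi_def)
      then show ?thesis using v by simp
    qed
    then show "c = c'"
      using c c' by (intro PiE_ext[of c ?V L]) (auto simp: transversals_def)
  qed
  moreover have "(\<lambda>c. c ` ?V) ` transversals G L H = cover_colorings G H"
  proof (intro set_eqI iffI)
    fix S assume "S \<in> (\<lambda>c. c ` ?V) ` transversals G L H"
    then obtain c where c: "c \<in> transversals G L H" and S: "S = c ` ?V" by blast
    have cL: "c u \<in> L u" if "u \<in> ?V" for u using c that by (auto simp: transversals_def)
    have "inj_on c ?V" using cL by (intro inj_onI) (metis disj)
    then have "card S = card ?V" by (simp add: S card_image)
    moreover have "S \<subseteq> verts H" using cL by (auto simp: S cover_lists[OF cov])
    moreover have "{c u, c v} \<notin> edges H" if uv: "u \<in> ?V" "v \<in> ?V" for u v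
    proof
      assume edge: "{c u, c v} \<in> edges H"
      then have "u \<noteq> v" using edge2 by force
      moreover have "edges_between H (L u) (L v) \<noteq> {}"
        using edge cL uv by (auto simp: edges_between_def)
      ultimately have "{u, v} \<in> edges G" using cov uv by (auto simp: cover_def)
      then show False using c edge by (auto simp: transversals_def)
    qed
    ultimately show "S \<in> cover_colorings G H"
      by (auto simp: S cover_colorings_def independent_set_def)
  next
    fix S assume S: "S \<in> cover_colorings G H"
    then have SH: "S \<subseteq> verts H" and cardS: "card S = card ?V"
      and indep: "\<And>x y. x \<in> S \<Longrightarrow> y \<in> S \<Longrightarrow> {x, y} \<notin> edges H"
      by (auto simp: cover_colorings_def independent_set_def)
    have "\<forall>x\<in>S. \<exists>u. u \<in> ?V \<and> x \<in> L u" using SH by (auto simp: cover_lists[OF cov])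
    then obtain own where own: "\<And>x. x \<in> S \<Longrightarrow> own x \<in> ?V \<and> x \<in> L (own x)"
      using bchoice by metis
    have inj: "inj_on own S"
    proof (rule inj_onI, rule ccontr)
      fix x y assume xy: "x \<in> S" "y \<in> S" "own x = own y" "x \<noteq> y"
      then have "{x, y} \<in> edges H" using cov own[of x] own[of y] by (auto simp: cover_def)
      then show False using indep xy by blast
    qed
    have "own ` S = ?V"
      using own cardS inj finV by (intro card_subset_eq) (auto simp: card_image)
    with inj have bij: "bij_betw own S ?V" by (simp add: bij_betw_def)
    define c where "c = restrict (inv_into S own) ?V"
    have img: "c ` ?V = S"
      using bij_betw_inv_into[OF bij] by (simp add: c_def bij_betw_def)
    have "c \<in> PiE ?V L"
    proof (rule PiE_I)
      fix u assume u: "u \<in> ?V"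
      then have "c u \<in> S" "own (c u) = u"
        using bij by (auto simp: c_def bij_betw_def inv_into_into f_inv_into_f)
      then show "c u \<in> L u" using own by metis
    qed (simp add: c_def)
    moreover have "{c u, c v} \<notin> edges H" if "{u, v} \<in> edges G" for u v
    proof -
      have "u \<in> ?V" "v \<in> ?V" using that G by (auto simp: simple_graph_def)
      then show ?thesis using indep img by blast
    qed
    ultimately have "c \<in> transversals G L H" by (simp add: transversals_def)
    with img show "S \<in> (\<lambda>c. c ` ?V) ` transversals G L H" by blast
  qed
  ultimately show ?thesis by (metis card_image)
qed

text \<open>Edges of a matching that share an endpoint coincide; this is the uniqueness on both
  sides that allows the extension to a bijection.\<close>

lemma m_fold_cover_edge_bij:
  assumes G: "simple_graph G" and cov: "m_fold_cover m G L H" and e: "{u, v} \<in> edges G"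
  shows "\<exists>f. bij_betw f (L u) (L v) \<and> (\<forall>x\<in>L u. \<forall>y\<in>L v. {x, y} \<in> edges H \<longrightarrow> f x = y)"
proof -
  have cover: "cover G L H" using cov by (simp add: m_fold_cover_def)
  have uv: "u \<in> verts G" "v \<in> verts G" and "u \<noteq> v"
    using G e by (auto simp: simple_graph_def)
  then have disj: "L u \<inter> L v = {}" using cover_disjoint[OF G cover] by blast
  have "finite (verts H)" using cover by (simp add: cover_def simple_graph_def)
  moreover have "L u \<subseteq> verts H" "L v \<subseteq> verts H" using uv cover_lists[OF cover] by auto
  ultimately have fin: "finite (L u)" "finite (L v)" by (simp_all add: finite_subset)
  have match: "{x, y} = {x', y'}"
    if "x \<in> L u" "y \<in> L v" "x' \<in> L u" "y' \<in> L v" "{x, y} \<in> edges H" "{x', y'} \<in> edges H"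
      "{x, y} \<inter> {x', y'} \<noteq> {}" for x y x' y'
  proof -
    have "disjoint (edges_between H (L u) (L v))" using cover e by (simp add: cover_def)
    moreover have "{x, y} \<in> edges_between H (L u) (L v)" "{x', y'} \<in> edges_between H (L u) (L v)"
      using that by (auto simp: edges_between_def)
    ultimately show ?thesis using that(7) by (metis disjointD)
  qed
  show ?thesis
  proof (rule partial_matching_extends_to_bij)
    show "card (L u) = card (L v)" using cov uv by (simp add: m_fold_cover_def)
    show "y = y'" if "x \<in> L u" "y \<in> L v" "y' \<in> L v" "{x, y} \<in> edges H" "{x, y'} \<in> edges H" for x y y'
      using match[of x y x y'] that disj by (auto simp: doubleton_eq_iff)
    show "x = x'" if "x \<in> L u" "x' \<in> L u" "y \<in> L v" "{x, y} \<in> edges H" "{x', y} \<in> edges H" for x x' y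
      using match[of x y x' y] that disj by (auto simp: doubleton_eq_iff)
  qed (use fin in auto)
qed

text \<open>\<open>H\<close> is the Cartesian product of \<open>G\<close> with a complete graph on
  \<open>m\<close> colors, and its transversals project injectively to proper colorings. It bounds
  \<open>P_DP\<close> from above and shows that the minimum ranges over a nonempty set.\<close>

lemma trivial_cover:
  fixes G :: "'a sgraph"
  assumes G: "simple_graph G" and "m \<ge> 1"
  shows "\<exists>(L :: 'a \<Rightarrow> nat set) H. m_fold_cover m G L H \<and>
    card (cover_colorings G H) \<le> chromatic_poly G m"
proof -
  let ?V = "verts G"
  have finV: "finite ?V" using G by (simp add: simple_graph_def)
  then obtain \<iota> :: "'a \<Rightarrow> nat" where \<iota>: "inj_on \<iota> ?V"
    using finite_imp_inj_to_nat_seg by metis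
  \<comment> \<open>Pairs of a vertex and a color are coded as numbers because \<open>P_DP\<close>
    ranges over covers on \<open>nat\<close>.\<close>
  define g where "g u a = prod_encode (\<iota> u, a)" for u a
  have g_eq: "g u a = g v b \<longleftrightarrow> u = v \<and> a = b" if "u \<in> ?V" "v \<in> ?V" for u v a b
    using \<iota> that by (auto simp: g_def prod_encode_eq inj_on_def)
  define L where "L u = g u ` {1..m}" for u
  define H where "H = \<lparr>verts = (\<Union>u\<in>?V. L u), edges = {{g u a, g v b} | u v a b.
    u \<in> ?V \<and> v \<in> ?V \<and> a \<in> {1..m} \<and> b \<in> {1..m} \<and> (u = v \<and> a \<noteq> b \<or> {u, v} \<in> edges G \<and> a = b)}\<rparr>"
  have loop: "{u} \<notin> edges G" for u using G by (auto simp: simple_graph_def)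
  have edge_iff: "{g u a, g v b} \<in> edges H \<longleftrightarrow> u = v \<and> a \<noteq> b \<or> {u, v} \<in> edges G \<and> a = b"
    if "u \<in> ?V" "v \<in> ?V" "a \<in> {1..m}" "b \<in> {1..m}" for u v a b
  proof
    assume "{g u a, g v b} \<in> edges H"
    then obtain u' v' a' b' where *: "{g u a, g v b} = {g u' a', g v' b'}" "u' \<in> ?V" "v' \<in> ?V"
      "u' = v' \<and> a' \<noteq> b' \<or> {u', v'} \<in> edges G \<and> a' = b'"
      by (auto simp: H_def)
    then show "u = v \<and> a \<noteq> b \<or> {u, v} \<in> edges G \<and> a = b"
      using that by (auto simp: doubleton_eq_iff g_eq insert_commute)
  next
    assume "u = v \<and> a \<noteq> b \<or> {u, v} \<in> edges G \<and> a = b"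
    then show "{g u a, g v b} \<in> edges H" unfolding H_def using that by auto
  qed
  have "simple_graph H"
  proof -
    have "card {g u a, g v b} = 2" if "u \<in> ?V" "v \<in> ?V" "u = v \<and> a \<noteq> b \<or> {u, v} \<in> edges G \<and> a = b"
      for u v a b
      using that loop[of u] g_eq[of u v a b] by (auto simp: card_2_iff)
    then show ?thesis using finV by (fastforce simp: simple_graph_def H_def L_def)
  qed
  moreover have "partition_on (verts H) (L ` ?V)"
    by (rule partition_onI)
      (use \<open>m \<ge> 1\<close> in \<open>auto simp: H_def L_def disjnt_def g_eq\<close>)
  moreover have "card (L ` ?V) = card ?V"
  proof (rule card_image, rule inj_onI)
    fix u v assume uv: "u \<in> ?V" "v \<in> ?V" "L u = L v"
    have "g u 1 \<in> L u" using \<open>m \<ge> 1\<close> by (auto simp: L_def)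
    then show "u = v" using uv by (auto simp: L_def g_eq)
  qed
  moreover have "{x, y} \<in> edges H" if "u \<in> ?V" "x \<in> L u" "y \<in> L u" "x \<noteq> y" for u x y
    using that by (auto simp: L_def edge_iff)
  moreover have "{u, v} \<in> edges G" if "u \<in> ?V" "v \<in> ?V" "u \<noteq> v" "edges_between H (L u) (L v) \<noteq> {}" for u v
    using that by (auto simp: L_def edges_between_def edge_iff)
  moreover have "disjoint (edges_between H (L u) (L v))" if "{u, v} \<in> edges G" for u v
  proof -
    have uv: "u \<in> ?V" "v \<in> ?V" "u \<noteq> v" using that G by (auto simp: simple_graph_def)
    then have "edges_between H (L u) (L v) \<subseteq> (\<lambda>a. {g u a, g v a}) ` {1..m}"
      by (auto simp: L_def edges_between_def edge_iff)
    moreover have "disjoint ((\<lambda>a. {g u a, g v a}) ` {1..m})"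
      using uv by (auto simp: disjoint_def g_eq)
    ultimately show ?thesis by (metis pairwise_subset)
  qed
  ultimately have cov: "cover G L H" unfolding cover_def by blast
  have "card (L u) = m" if "u \<in> ?V" for u
    unfolding L_def using that by (subst card_image) (auto intro: inj_onI simp: g_eq)
  with cov have mcov: "m_fold_cover m G L H" by (simp add: m_fold_cover_def)
  define col where "col c = restrict (\<lambda>u. snd (prod_decode (c u))) ?V" for c :: "'a \<Rightarrow> nat"
  have col: "col c u \<in> {1..m} \<and> c u = g u (col c u)" if "c \<in> transversals G L H" "u \<in> ?V" for c u
  proof -
    have "c u \<in> L u" using that by (auto simp: transversals_def)
    then show ?thesis using that(2) by (auto simp: L_def col_def g_def)
  qed
  have "card (transversals G L H) \<le> card (proper_colorings G m)"
  proof (rule card_inj_on_le)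
    show "inj_on col (transversals G L H)"
    proof (rule inj_onI)
      fix c c' assume c: "c \<in> transversals G L H" "c' \<in> transversals G L H" "col c = col c'"
      have "c u = c' u" if "u \<in> ?V" for u
        using col[OF c(1) that] col[OF c(2) that] c(3) by metis
      then show "c = c'"
        using c(1,2) by (intro PiE_ext[of c ?V L]) (auto simp: transversals_def)
    qed
    show "col ` transversals G L H \<subseteq> proper_colorings G m"
    proof (rule image_subsetI)
      fix c assume c: "c \<in> transversals G L H"
      have "col c u \<noteq> col c v" if "{u, v} \<in> edges G" for u v
      proof -
        have uv: "u \<in> ?V" "v \<in> ?V" using that G by (auto simp: simple_graph_def)
        have "{c u, c v} \<notin> edges H" using c that by (auto simp: transversals_def)
        then show ?thesis
          using edge_iff[of u v "col c u" "col c v"] col[OF c] uv that by metis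
      qed
      moreover have "col c \<in> ?V \<rightarrow>\<^sub>E {1..m}"
        using col[OF c] by (intro PiE_I) (auto simp: col_def)
      ultimately show "col c \<in> proper_colorings G m" by (simp add: proper_colorings_def)
    qed
    show "finite (proper_colorings G m)"
      unfolding proper_colorings_def using finV
      by (intro finite_subset[OF _ finite_PiE[of ?V "\<lambda>_. {1..m}"]]) auto
  qed
  then have "card (cover_colorings G H) \<le> chromatic_poly G m"
    using card_cover_colorings[OF G cov] by (simp add: chromatic_poly_def)
  with mcov show ?thesis by blast
qed

text \<open>Provides coordinates: \<open>g (i, j)\<close> is the vertex at position \<open>j\<close>
  of the cycle with index \<open>i\<close>.\<close>

lemma iso_disjoint_union_cycles:
  assumes G: "simple_graph G" and iso: "G \<cong>\<^sub>g disjoint_union I (\<lambda>i. cycle_graph (k i))"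
  obtains g where "bij_betw g (SIGMA i:I. {..<k i}) (verts G)"
    "edges G = {{g (i, j), g (i, Suc j mod k i)} | i j. i \<in> I \<and> j < k i}"
proof -
  let ?D = "disjoint_union I (\<lambda>i. cycle_graph (k i))" and ?S = "SIGMA i:I. {..<k i}"
  have vD: "verts ?D = ?S" by (simp add: disjoint_union_def cycle_graph_def)
  have eD: "edges ?D = {{(i, j), (i, Suc j mod k i)} | i j. i \<in> I \<and> j < k i}"
    by (auto simp: disjoint_union_def cycle_graph_def) blast
  obtain f where f: "bij_betw f (verts G) ?S"
    and fe: "\<And>u v. u \<in> verts G \<Longrightarrow> v \<in> verts G \<Longrightarrow> {u, v} \<in> edges G \<longleftrightarrow> {f u, f v} \<in> edges ?D"
    using iso by (auto simp: graph_iso_def vD)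
  define g where "g = inv_into (verts G) f"
  have g: "bij_betw g ?S (verts G)" using f by (simp add: g_def bij_betw_inv_into)
  have fg: "f (g z) = z" if "z \<in> ?S" for z
    using f that by (simp add: g_def bij_betw_inv_into_right)
  have gf: "g (f u) = u" if "u \<in> verts G" for u
    using f that by (simp add: g_def bij_betw_inv_into_left)
  have "edges G = {{g (i, j), g (i, Suc j mod k i)} | i j. i \<in> I \<and> j < k i}"
  proof (intro set_eqI iffI)
    fix e assume e: "e \<in> edges G"
    then obtain u v where uv: "e = {u, v}" "u \<in> verts G" "v \<in> verts G"
      using G by (auto simp: simple_graph_def card_2_iff)
    then obtain i j where ij: "i \<in> I" "j < k i" "{f u, f v} = {(i, j), (i, Suc j mod k i)}"
      using e fe[of u v] by (auto simp: eD)
    have "e = g ` {f u, f v}" using uv gf by simp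
    also have "\<dots> = {g (i, j), g (i, Suc j mod k i)}" by (simp add: ij(3))
    finally show "e \<in> {{g (i, j), g (i, Suc j mod k i)} | i j. i \<in> I \<and> j < k i}"
      using ij by blast
  next
    fix e assume "e \<in> {{g (i, j), g (i, Suc j mod k i)} | i j. i \<in> I \<and> j < k i}"
    then obtain i j where ij: "i \<in> I" "j < k i" "e = {g (i, j), g (i, Suc j mod k i)}" by blast
    then have S: "(i, j) \<in> ?S" "(i, Suc j mod k i) \<in> ?S" by auto
    have "g (i, j) \<in> verts G" "g (i, Suc j mod k i) \<in> verts G"
      using bij_betwE[OF g] S by blast+
    then show "e \<in> edges G"
      using fe[of "g (i, j)" "g (i, Suc j mod k i)"] fg[OF S(1)] fg[OF S(2)] ij by (auto simp: eD)
  qed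
  with g show thesis by (rule that)
qed

section \<open>Joins of a vertex with cycles\<close>

lemma edges_join_K1:
  "edges (graph_join K1 G) = (`) Inr ` edges G \<union> {{Inl (), Inr a} | a. a \<in> verts G}"
  by (auto simp: graph_join_def K1_def)

lemma verts_join_K1: "verts (graph_join K1 G) = insert (Inl ()) (Inr ` verts G)"
  by (auto simp: graph_join_def K1_def)

lemma edges_join_K1_Inr: "{u, v} \<in> edges G \<Longrightarrow> {Inr u, Inr v} \<in> edges (graph_join K1 G)"
  unfolding edges_join_K1 by (intro UnI1 image_eqI[of _ _ "{u, v}"]) auto

lemma simple_graph_join_K1: "simple_graph G \<Longrightarrow> simple_graph (graph_join K1 G)"
  by (rule simple_graph_join) (simp_all add: simple_graph_def K1_def)

text \<open>A color \<open>x\<close> of the apex and one closed walk in \<open>X - {x}\<close> per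
  cycle yield a transversal, by transport along the spokes. This map is injective; the inequality
  may be strict because the bijections can forbid more than the cover does.\<close>

lemma cover_colorings_join_K1_cycles_ge:
  fixes G :: "'a sgraph" and k :: "'i \<Rightarrow> nat" and L :: "unit + 'a \<Rightarrow> 'b set"
  assumes G: "simple_graph G" and "finite I"
    and g: "bij_betw g (SIGMA i:I. {..<k i}) (verts G)"
    and eG: "edges G = {{g (i, j), g (i, Suc j mod k i)} | i j. i \<in> I \<and> j < k i}"
    and cov: "m_fold_cover m (graph_join K1 G) L H"
  obtains X :: "'b set" and \<pi> where "finite X" "card X = m"
    "\<And>i j. i \<in> I \<Longrightarrow> j < k i \<Longrightarrow> bij_betw (\<pi> i j) X X"
    "(\<Sum>x\<in>X. \<Prod>i\<in>I. card (closed_walks (k i) (X - {x}) (\<lambda>j a b. \<pi> i j a \<noteq> b))) \<le>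
       card (cover_colorings (graph_join K1 G) H)"
proof -
  let ?M = "graph_join K1 G" and ?S = "SIGMA i:I. {..<k i}"
  have M: "simple_graph ?M" using G by (rule simple_graph_join_K1)
  have cover: "cover ?M L H" using cov by (simp add: m_fold_cover_def)
  define X where "X = L (Inl ())"
  have cardX: "card X = m" using cov by (simp add: X_def m_fold_cover_def verts_join_K1)
  have "finite (verts H)" using cover by (simp add: cover_def simple_graph_def)
  then have finX: "finite X"
    using cover_lists[OF cover] by (simp add: X_def verts_join_K1)
  have gV: "g z \<in> verts G" if "z \<in> ?S" for z using bij_betwE[OF g] that by blast
  have S: "(i, j) \<in> ?S" "(i, Suc j mod k i) \<in> ?S" if "i \<in> I" "j < k i" for i j
    using that by auto
  have "\<forall>a\<in>verts G. \<exists>f. bij_betw f X (L (Inr a)) \<and>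
      (\<forall>x\<in>X. \<forall>y\<in>L (Inr a). {x, y} \<in> edges H \<longrightarrow> f x = y)"
    unfolding X_def by (intro ballI m_fold_cover_edge_bij[OF M cov]) (auto simp: edges_join_K1)
  then obtain \<phi> where \<phi>: "\<And>a. a \<in> verts G \<Longrightarrow> bij_betw (\<phi> a) X (L (Inr a))"
    and \<phi>_edge: "\<And>a x y. a \<in> verts G \<Longrightarrow> x \<in> X \<Longrightarrow> y \<in> L (Inr a) \<Longrightarrow> {x, y} \<in> edges H \<Longrightarrow> \<phi> a x = y"
    by (metis bchoice)
  have edgeM: "{Inr (g (i, j)), Inr (g (i, Suc j mod k i))} \<in> edges ?M" if "i \<in> I" "j < k i" for i j
    using eG that by (intro edges_join_K1_Inr) blast
  have "\<forall>z\<in>?S. \<exists>f. bij_betw f (L (Inr (g z))) (L (Inr (g (fst z, Suc (snd z) mod k (fst z))))) \<and>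
      (\<forall>x\<in>L (Inr (g z)). \<forall>y\<in>L (Inr (g (fst z, Suc (snd z) mod k (fst z)))). {x, y} \<in> edges H \<longrightarrow> f x = y)"
    using edgeM by (intro ballI m_fold_cover_edge_bij[OF M cov]) auto
  then obtain \<psi> where \<psi>_all: "\<And>z. z \<in> ?S \<Longrightarrow>
      bij_betw (\<psi> z) (L (Inr (g z))) (L (Inr (g (fst z, Suc (snd z) mod k (fst z))))) \<and>
      (\<forall>x\<in>L (Inr (g z)). \<forall>y\<in>L (Inr (g (fst z, Suc (snd z) mod k (fst z)))). {x, y} \<in> edges H \<longrightarrow> \<psi> z x = y)"
    by (metis (no_types, lifting) bchoice)
  have \<psi>: "bij_betw (\<psi> (i, j)) (L (Inr (g (i, j)))) (L (Inr (g (i, Suc j mod k i))))"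
    if "i \<in> I" "j < k i" for i j
    using \<psi>_all[OF S(1)[OF that]] by simp
  have \<psi>_edge: "\<psi> (i, j) x = y"
    if "i \<in> I" "j < k i" "x \<in> L (Inr (g (i, j)))" "y \<in> L (Inr (g (i, Suc j mod k i)))" "{x, y} \<in> edges H"
    for i j x y
    using \<psi>_all[OF S(1)[OF that(1,2)]] that(3-5) by simp
  \<comment> \<open>The bijection of a cycle edge, read as a permutation of \<open>X\<close> through
    the spoke bijections of its two ends.\<close>
  define \<pi> where "\<pi> i j = inv_into X (\<phi> (g (i, Suc j mod k i))) \<circ> (\<psi> (i, j) \<circ> \<phi> (g (i, j)))" for i j
  have \<pi>: "bij_betw (\<pi> i j) X X" if "i \<in> I" "j < k i" for i j
  proof -
    have "bij_betw (\<phi> (g (i, j))) X (L (Inr (g (i, j))))"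
      using \<phi>[OF gV[OF S(1)[OF that]]] .
    moreover have "bij_betw (inv_into X (\<phi> (g (i, Suc j mod k i)))) (L (Inr (g (i, Suc j mod k i)))) X"
      using \<phi>[OF gV[OF S(2)[OF that]]] by (rule bij_betw_inv_into)
    ultimately show ?thesis
      unfolding \<pi>_def using \<psi>[OF that] by (blast intro: bij_betw_trans)
  qed
  define W where "W x i = closed_walks (k i) (X - {x}) (\<lambda>j a b. \<pi> i j a \<noteq> b)" for x i
  have finW: "finite (W x i)" for x i unfolding W_def using finX by (intro finite_closed_walks) simp
  define h where "h = inv_into ?S g"
  have hg: "h (g z) = z" if "z \<in> ?S" for z
    using g that by (simp add: h_def bij_betw_inv_into_left)
  have hS: "h a \<in> ?S" and gh: "g (h a) = a" if "a \<in> verts G" for a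
    using g that by (auto simp: h_def bij_betw_inv_into_right inv_into_into bij_betw_def)
  \<comment> \<open>\<open>h a\<close> recovers the coordinates of \<open>a\<close>, and
    \<open>\<phi> a\<close> moves the color found there from \<open>X\<close> into the list of
    \<open>a\<close>.\<close>
  define col where "col = (\<lambda>(x, d). restrict (case_sum (\<lambda>_. x)
    (\<lambda>a. \<phi> a (d (fst (h a)) (snd (h a))))) (verts ?M))"
  have col_Inl: "col (x, d) (Inl ()) = x" for x d by (simp add: col_def verts_join_K1)
  have col_Inr: "col (x, d) (Inr (g (i, j))) = \<phi> (g (i, j)) (d i j)" if "(i, j) \<in> ?S" for x d i j
    using hg[OF that] gV[OF that] by (simp add: col_def verts_join_K1)
  have W_mem: "d i j \<in> X" "d i j \<noteq> x" if "d \<in> PiE I (W x)" "(i, j) \<in> ?S" for x d i j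
  proof -
    have "d i \<in> W x i" "j < k i" using that by auto
    then have "d i j \<in> X - {x}" by (auto simp: W_def closed_walks_def)
    then show "d i j \<in> X" "d i j \<noteq> x" by auto
  qed
  have "card (SIGMA x:X. PiE I (W x)) \<le> card (transversals ?M L H)"
  proof (rule card_inj_on_le)
    show "inj_on col (SIGMA x:X. PiE I (W x))"
    proof (rule inj_onI, clarify)
      fix x d x' d' assume x: "x \<in> X" "x' \<in> X" and d: "d \<in> PiE I (W x)" "d' \<in> PiE I (W x')"
        and eq: "col (x, d) = col (x', d')"
      have xx: "x = x'" using col_Inl eq by metis
      have dij: "d i j = d' i j" if "(i, j) \<in> ?S" for i j
      proof -
        have "\<phi> (g (i, j)) (d i j) = \<phi> (g (i, j)) (d' i j)"
          using col_Inr[OF that] eq by metis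
        then show ?thesis
          using \<phi>[OF gV[OF that]] W_mem(1)[OF d(1) that] W_mem(1)[OF d(2) that]
          by (auto simp: bij_betw_def inj_on_def)
      qed
      have "d i = d' i" if "i \<in> I" for i
      proof (rule PiE_ext[of "d i" "{..<k i}" "\<lambda>_. X - {x}"])
        have "d i \<in> W x i" "d' i \<in> W x i" using d xx that by auto
        then show "d i \<in> {..<k i} \<rightarrow>\<^sub>E X - {x}" "d' i \<in> {..<k i} \<rightarrow>\<^sub>E X - {x}"
          by (simp_all add: W_def closed_walks_def)
      qed (use dij that in auto)
      then have "d = d'" using d xx by (intro PiE_ext[of d I "W x"]) auto
      with xx show "x = x' \<and> d = d'" by simp
    qed
    show "col ` (SIGMA x:X. PiE I (W x)) \<subseteq> transversals ?M L H"
    proof (rule image_subsetI, clarify)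
      fix x d assume x: "x \<in> X" and d: "d \<in> PiE I (W x)"
      let ?c = "col (x, d)"
      have Inr_mem: "?c (Inr (g (i, j))) \<in> L (Inr (g (i, j)))" if "(i, j) \<in> ?S" for i j
        using \<phi>[OF gV[OF that]] W_mem(1)[OF d that] by (auto simp: col_Inr[OF that] bij_betw_def)
      have Inr_mem': "?c (Inr a) \<in> L (Inr a)" if "a \<in> verts G" for a
        using Inr_mem[of "fst (h a)" "snd (h a)"] hS[OF that] gh[OF that] by simp
      have "?c \<in> PiE (verts ?M) L"
      proof (rule PiE_I)
        fix u assume "u \<in> verts ?M"
        then show "?c u \<in> L u"
          using Inr_mem' x col_Inl by (auto simp: verts_join_K1 X_def)
      qed (simp add: col_def)
      moreover have "?c ` e \<notin> edges H" if "e \<in> edges ?M" for e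
      proof
        assume edge: "?c ` e \<in> edges H"
        from that consider a where "a \<in> verts G" "e = {Inl (), Inr a}"
          | i j where "i \<in> I" "j < k i" "e = {Inr (g (i, j)), Inr (g (i, Suc j mod k i))}"
          by (auto simp: edges_join_K1 eG)
        then show False
        proof cases
          \<comment> \<open>On a spoke, adjacency would force the walk to visit
            \<open>x\<close>.\<close>
          case 1
          obtain i j where ij: "h a = (i, j)" by fastforce
          have S': "(i, j) \<in> ?S" and a: "g (i, j) = a" using hS[OF 1(1)] gh[OF 1(1)] ij by auto
          have "{x, ?c (Inr a)} \<in> edges H" using edge 1(2) by (simp add: col_Inl)
          then have "\<phi> a x = ?c (Inr a)" using \<phi>_edge 1(1) x Inr_mem' by blast
          also have "\<dots> = \<phi> a (d i j)" using col_Inr[OF S'] a by simp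
          finally have "x = d i j"
            using \<phi>[OF 1(1)] x W_mem(1)[OF d S'] by (auto simp: bij_betw_def inj_on_def)
          then show False using W_mem(2)[OF d S'] by simp
        next
          \<comment> \<open>On a cycle edge, adjacency would force a step that
            \<open>\<pi> i j\<close> forbids.\<close>
          case 2
          let ?j = "Suc j mod k i"
          note S' = S[OF 2(1,2)]
          have "\<psi> (i, j) (?c (Inr (g (i, j)))) = ?c (Inr (g (i, ?j)))"
            using \<psi>_edge[OF 2(1,2) Inr_mem[OF S'(1)] Inr_mem[OF S'(2)]] edge 2(3) by simp
          then have "\<psi> (i, j) (\<phi> (g (i, j)) (d i j)) = \<phi> (g (i, ?j)) (d i ?j)"
            by (simp only: col_Inr[OF S'(1)] col_Inr[OF S'(2)])
          then have "\<pi> i j (d i j) = d i ?j"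
            using bij_betw_inv_into_left[OF \<phi>[OF gV[OF S'(2)]] W_mem(1)[OF d S'(2)]]
            by (simp add: \<pi>_def)
          moreover have "\<pi> i j (d i j) \<noteq> d i ?j"
          proof -
            have "d i \<in> W x i" using d 2(1) by auto
            then show ?thesis using 2(2) by (simp add: W_def closed_walks_def)
          qed
          ultimately show False by simp
        qed
      qed
      then have "{?c u, ?c v} \<notin> edges H" if "{u, v} \<in> edges ?M" for u v
        using that by force
      ultimately show "?c \<in> transversals ?M L H" by (simp add: transversals_def)
    qed
  qed (rule finite_transversals[OF M cover])
  also have "card (transversals ?M L H) = card (cover_colorings ?M H)"
    using card_cover_colorings[OF M cover] by simp
  also have "card (SIGMA x:X. PiE I (W x)) = (\<Sum>x\<in>X. \<Prod>i\<in>I. card (W x i))"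
    using finX finW \<open>finite I\<close> by (simp add: card_PiE finite_PiE)
  finally have "(\<Sum>x\<in>X. \<Prod>i\<in>I. card (W x i)) \<le> card (cover_colorings ?M H)" .
  with finX cardX \<pi> show thesis unfolding W_def by (rule that)
qed

text \<open>A proper coloring splits into the color of the apex and, on each cycle, a closed walk
  that avoids this color and changes color at every step.\<close>

lemma chromatic_poly_join_K1_cycles_le:
  fixes G :: "'a sgraph" and k :: "'i \<Rightarrow> nat"
  assumes "finite I"
    and g: "bij_betw g (SIGMA i:I. {..<k i}) (verts G)"
    and eG: "edges G = {{g (i, j), g (i, Suc j mod k i)} | i j. i \<in> I \<and> j < k i}"
  shows "chromatic_poly (graph_join K1 G) m \<le>
    (\<Sum>x\<in>{1..m}. \<Prod>i\<in>I. card (closed_walks (k i) ({1..m} - {x}) (\<lambda>j a b. a \<noteq> b)))"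
proof -
  let ?M = "graph_join K1 G" and ?S = "SIGMA i:I. {..<k i}"
  define W where "W x i = closed_walks (k i) ({1..m} - {x}) (\<lambda>j a b. a \<noteq> b)" for x i
  have finW: "finite (W x i)" for x i unfolding W_def by (intro finite_closed_walks) simp
  define dec where "dec c = (c (Inl ()), \<lambda>i\<in>I. \<lambda>j\<in>{..<k i}. c (Inr (g (i, j))))" for c :: "unit + 'a \<Rightarrow> nat"
  have "card (proper_colorings ?M m) \<le> card (SIGMA x:{1..m}. PiE I (W x))"
  proof (rule card_inj_on_le)
    show "inj_on dec (proper_colorings ?M m)"
    proof (rule inj_onI)
      fix c c' assume c: "c \<in> proper_colorings ?M m" "c' \<in> proper_colorings ?M m" and eq: "dec c = dec c'"
      have "c (Inr (g (i, j))) = c' (Inr (g (i, j)))" if "i \<in> I" "j < k i" for i j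
      proof -
        have "snd (dec c) i j = snd (dec c') i j" using eq by simp
        then show ?thesis using that by (simp add: dec_def)
      qed
      moreover have "\<exists>i j. i \<in> I \<and> j < k i \<and> a = g (i, j)" if "a \<in> verts G" for a
      proof -
        have "a \<in> g ` ?S" using g that by (simp add: bij_betw_def)
        then show ?thesis by auto
      qed
      ultimately have "c (Inr a) = c' (Inr a)" if "a \<in> verts G" for a
        using that by metis
      moreover have "c (Inl ()) = c' (Inl ())" using eq by (simp add: dec_def)
      ultimately show "c = c'"
        using c by (intro PiE_ext[of c "verts ?M" "\<lambda>_. {1..m}"])
          (auto simp: proper_colorings_def verts_join_K1)
    qed
    show "dec ` proper_colorings ?M m \<subseteq> (SIGMA x:{1..m}. PiE I (W x))"
    proof (rule image_subsetI)
      fix c assume c: "c \<in> proper_colorings ?M m"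
      let ?x = "c (Inl ())" and ?d = "\<lambda>i. \<lambda>j\<in>{..<k i}. c (Inr (g (i, j)))"
      have range: "c u \<in> {1..m}" if "u \<in> verts ?M" for u
        using c that unfolding proper_colorings_def by blast
      have proper: "c u \<noteq> c v" if "{u, v} \<in> edges ?M" for u v
        using c that by (auto simp: proper_colorings_def)
      have "?d i \<in> W ?x i" if "i \<in> I" for i
      proof -
        have gV: "g (i, j) \<in> verts G" if "j < k i" for j
          using bij_betwE[OF g] that \<open>i \<in> I\<close> by blast
        have "c (Inr (g (i, j))) \<in> {1..m} - {?x}" if "j < k i" for j
        proof -
          have "{Inl (), Inr (g (i, j))} \<in> edges ?M" using gV[OF that] by (auto simp: edges_join_K1)
          then have "?x \<noteq> c (Inr (g (i, j)))" by (rule proper)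
          moreover have "c (Inr (g (i, j))) \<in> {1..m}"
            using gV[OF that] by (intro range) (simp add: verts_join_K1)
          ultimately show ?thesis by auto
        qed
        moreover have "c (Inr (g (i, j))) \<noteq> c (Inr (g (i, Suc j mod k i)))" if "j < k i" for j
          using eG that \<open>i \<in> I\<close> by (intro proper edges_join_K1_Inr) blast
        moreover have "Suc j mod k i < k i" if "j < k i" for j using that by simp
        ultimately show ?thesis by (auto simp: W_def closed_walks_def)
      qed
      moreover have "?x \<in> {1..m}" by (rule range) (simp add: verts_join_K1)
      ultimately show "dec c \<in> (SIGMA x:{1..m}. PiE I (W x))" unfolding dec_def by auto
    qed
    show "finite (SIGMA x:{1..m}. PiE I (W x))"
      using finW \<open>finite I\<close> by (intro finite_SigmaI finite_PiE) auto
  qed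
  also have "\<dots> = (\<Sum>x\<in>{1..m}. \<Prod>i\<in>I. card (W x i))"
    using finW \<open>finite I\<close> by (simp add: card_PiE finite_PiE)
  finally show ?thesis by (simp add: chromatic_poly_def W_def)
qed

section \<open>Equality of the two counts and the threshold\<close>

theorem theorem3p15:
  fixes n :: nat and k :: "nat \<Rightarrow> nat"
    and G :: "'a sgraph" and M :: "(unit + 'a) sgraph"
  assumes "n \<ge> 2"
    and "\<And>i. i \<in> {1..n} \<Longrightarrow> k i \<ge> 3"
    and "simple_graph G"
    and "G \<cong>\<^sub>g disjoint_union {1..n} (\<lambda>i. cycle_graph (k i))"
    and "M = graph_join K1 G"
  shows "(\<forall>m::nat. m \<ge> 5 \<longrightarrow> P_DP M m = chromatic_poly M m) \<and> tau_DP M \<le> 5"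
proof -
  obtain g where g: "bij_betw g (SIGMA i:{1..n}. {..<k i}) (verts G)"
    and eG: "edges G = {{g (i, j), g (i, Suc j mod k i)} | i j. i \<in> {1..n} \<and> j < k i}"
    using iso_disjoint_union_cycles[OF assms(3,4)] .
  have M: "simple_graph M" using assms(3,5) simple_graph_join_K1 by blast
  have eq: "P_DP M m = chromatic_poly M m" and pos: "P_DP M m > 0" if "m \<ge> 5" for m
  proof -
    obtain p where p: "m = Suc p" "p \<ge> 4" using \<open>m \<ge> 5\<close> by (cases m) auto
    \<comment> \<open>\<open>B\<close> is the count for identity permutations. The goal is the chain
      \<open>P_DP M m \<le> chromatic_poly M m \<le> B \<le> P_DP M m\<close>.\<close>
    define B where "B = int (Suc p) * (\<Prod>i\<in>{1..n}. cycle_poly (k i) p)"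
    have "(\<Prod>i\<in>{1..n}. cycle_poly (k i) p) > 0"
    proof (rule prod_pos)
      fix i assume "i \<in> {1..n}"
      then have "k i \<ge> 3" by (rule assms(2))
      then show "cycle_poly (k i) p > 0" using p by (intro cycle_poly_pos) auto
    qed
    then have "B > 0" by (simp add: B_def)
    let ?C = "{card (cover_colorings M H) | (L :: unit + 'a \<Rightarrow> nat set) H. m_fold_cover m M L H}"
    obtain L0 :: "unit + 'a \<Rightarrow> nat set" and H0 where
      triv: "m_fold_cover m M L0 H0" "card (cover_colorings M H0) \<le> chromatic_poly M m"
      using trivial_cover[OF M, of m] \<open>m \<ge> 5\<close> by auto
    have "P_DP M m \<le> card (cover_colorings M H0)" using P_DP_le[OF M triv(1)] .
    then have upper: "P_DP M m \<le> chromatic_poly M m" using triv(2) by simp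
    have "card (cover_colorings M H0) \<in> ?C" using triv(1) by blast
    \<comment> \<open>The infimum of a nonempty set of naturals is attained, so some cover realizes
      \<open>P_DP M m\<close>.\<close>
    then have "P_DP M m \<in> ?C" unfolding P_DP_def by (rule wellorder_InfI)
    then obtain L :: "unit + 'a \<Rightarrow> nat set" and H where
      LH: "m_fold_cover m M L H" "P_DP M m = card (cover_colorings M H)" by blast
    obtain X :: "nat set" and \<pi> where X: "finite X" "card X = m"
      and \<pi>: "\<And>i j. i \<in> {1..n} \<Longrightarrow> j < k i \<Longrightarrow> bij_betw (\<pi> i j) X X"
      and le: "(\<Sum>x\<in>X. \<Prod>i\<in>{1..n}. card (closed_walks (k i) (X - {x}) (\<lambda>j a b. \<pi> i j a \<noteq> b))) \<le>
        card (cover_colorings (graph_join K1 G) H)"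
      by (rule cover_colorings_join_K1_cycles_ge[OF assms(3) finite_atLeastAtMost g eG
          LH(1)[unfolded assms(5)]]) (rule that)
    have "B \<le> int (\<Sum>x\<in>X. \<Prod>i\<in>{1..n}. card (closed_walks (k i) (X - {x}) (\<lambda>j a b. \<pi> i j a \<noteq> b)))"
      unfolding B_def using X p assms(2) \<pi> by (intro sum_prod_closed_walks_ge) auto
    also have "\<dots> \<le> int (P_DP M m)"
      unfolding LH(2) unfolding assms(5) using le by (rule of_nat_mono)
    finally have lower: "B \<le> int (P_DP M m)" .
    have "int (chromatic_poly M m) \<le>
        int (\<Sum>x\<in>{1..m}. \<Prod>i\<in>{1..n}. card (closed_walks (k i) ({1..m} - {x}) (\<lambda>j a b. a \<noteq> b)))"
      unfolding assms(5)
      by (intro of_nat_mono chromatic_poly_join_K1_cycles_le[OF finite_atLeastAtMost g eG])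
    also have "\<dots> = B"
      unfolding B_def
    proof (rule sum_prod_closed_walks_id)
      show "k i > 0" if "i \<in> {1..n}" for i using assms(2)[OF that] by simp
    qed (use p in simp_all)
    finally have "int (chromatic_poly M m) \<le> B" .
    then show "P_DP M m = chromatic_poly M m" using upper lower by linarith
    show "P_DP M m > 0" using \<open>B > 0\<close> lower by linarith
  qed
  \<comment> \<open>\<open>tau_bound\<close> also requires 5 to be at least the chromatic number;
    positivity of the count at 5 supplies a proper coloring.\<close>
  have "proper_colorings M 5 \<noteq> {}"
    using eq[of 5] pos[of 5] by (auto simp: chromatic_poly_def)
  then have "chromatic_number M \<le> 5" unfolding chromatic_number_def by (rule Least_le)
  then have tau: "tau_bound M 5" using eq by (simp add: tau_bound_def)
  then have "(LEAST N. tau_bound M N) \<le> 5" by (rule Least_le)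
  then have "tau_DP M \<le> enat 5" using tau by (auto simp: tau_DP_def)
  then have "tau_DP M \<le> 5" by (simp add: numeral_eq_enat)
  with eq show ?thesis by blast
qed

end
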